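(* For each integer $n\ge 5$, there exist elements $x,y$ of the alternating group $A_n$, at least one of which has prime order, such that $x$ and $y$ generate $A_n$ invariably, that is, $\langle x^g,y^h\rangle=A_n$ for all $g,h\in A_n$.
   Context: For elements $x,g$ of a group, $x^g=g^{-1}xg$. Elements $x,y$ of a group $G$ generate $G$ invariably if $\langle x^g,y^h\rangle=G$ for all $g,h\in G$. *)

theory Defs
  imports
    "HOL-Computational_Algebra.Primes"
    "HOL-Algebra.Multiplicative_Group"
    "HOL-Algebra.Sym_Groups"
begin

text \<open>
  \<open>conj_by G x g\<close> is \<open>x\<^sup>g\<close> in the right-action convention, i.e. the conjugating
  element is the second argument.
\<close>

definition conj_by :: "('a, 'b) monoid_scheme \<Rightarrow> 'a \<Rightarrow> 'a \<Rightarrow> 'a" where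
  "conj_by G x g = inv\<^bsub>G\<^esub> g \<otimes>\<^bsub>G\<^esub> x \<otimes>\<^bsub>G\<^esub> g"

definition generate_invariably :: "('a, 'b) monoid_scheme \<Rightarrow> 'a \<Rightarrow> 'a \<Rightarrow> bool" where
  "generate_invariably G x y \<longleftrightarrow>
     x \<in> carrier G \<and> y \<in> carrier G \<and>
     (\<forall>g \<in> carrier G. \<forall>h \<in> carrier G. generate G {conj_by G x g, conj_by G y h} = carrier G)"

end

theory Submission
  imports Defs "HOL-Combinatorics.Orbits"
begin

text \<open>
  Let \<open>x\<close> be a permutation of \<open>{1..n}\<close> all of whose cycles have the same prime length \<open>p\<close>, so that
  every set invariant under a conjugate of \<open>x\<close> has size divisible by \<open>p\<close>. If no proper nonempty
  subfamily of the cycles of \<open>y\<close>, fixed points included, has total length divisible by \<open>p\<close>, then any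
  conjugate of \<open>x\<close> and any conjugate of \<open>y\<close> together generate a transitive group \<open>G\<close>. This, and
  everything used below, depends on the cycle types only and hence does not notice the conjugating
  elements. It remains to choose the cycle type of \<open>y\<close> so that \<open>G\<close> must contain every 3-cycle; the
  3-cycles generate the alternating group.

  For prime \<open>n\<close> a transitive group is primitive. Otherwise a power of \<open>y\<close> will be a single cycle
  moving more than half of the points and fixing a number of points coprime to \<open>n\<close>. A block that meets the fixed points of such a cycle lies inside them, so the
  block size divides both \<open>n\<close> and the number of fixed points, and \<open>G\<close> is primitive
  (\<open>primitive_of_long_cycle\<close>). The source of all 3-cycles is the commutator of two permutations whose
  supports share exactly one point (\<open>commutator_eq_three_cycle\<close>). Two ways of finding such a pair are
  used.

  The first is a theorem of Jordan: in a primitive group containing a cycle \<open>z\<close> of prime length \<open>q\<close>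
  the conjugates of the support of \<open>z\<close> are all the \<open>q\<close>-element sets
  (\<open>all_subsets_are_translates\<close>). If \<open>2 q \<le> n + 1\<close>, supports meeting in one prescribed point are
  therefore available. The second applies to doubly transitive groups: averaging over a point
  stabilizer shows that an element of support size \<open>s\<close> with \<open>(s - 1)\<^sup>2 < n - 1\<close> has a conjugate whose
  support meets its own in one point (\<open>exists_translate_meeting_in_point\<close>). Double transitivity is
  again a consequence of the long cycle (\<open>doubly_transitive_of_long_cycle\<close>).

  The choices are as follows.
  \<^item> For prime \<open>n\<close>, \<open>x\<close> is an \<open>n\<close>-cycle and \<open>y\<close> a 3-cycle.
  \<^item> For even \<open>n \<ge> 8\<close>, \<open>y\<close> has cycles of lengths \<open>q\<close> and \<open>n - q\<close>, with \<open>q\<close> a prime that does not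
    divide \<open>n\<close> and satisfies \<open>2 q < n\<close>; any prime factor of the odd one among
    \<open>n/2 - 1\<close> and \<open>n/2 - 2\<close> will do.
  \<^item> For odd composite \<open>n\<close>, \<open>y\<close> has cycles of lengths 2, 2 and \<open>n - 4\<close>. Its square is a long cycle, and
    a suitable odd power is a double transposition, of support size 4, to which averaging applies once
    \<open>n \<ge> 11\<close>. For \<open>n = 9\<close> the long cycle has prime length 5 and Jordan's theorem applies.
  \<^item> For \<open>n = 6\<close> there is no such \<open>q\<close>. Here \<open>x\<close> is a 5-cycle and \<open>y\<close> has cycles of lengths 2 and 4.
    Sets invariant under \<open>x\<close> have 0, 1, 5 or 6 elements and those invariant under \<open>y\<close> an even number,
    so the group is transitive. The 5-cycle takes the role of the long cycle, and a short word in
    conjugates of \<open>x\<close> and \<open>y\<close> is a 3-cycle.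
\<close>

section \<open>Cycles of a permutation\<close>

lemma cyclic_on_reach:
  assumes "cyclic_on f C" "u \<in> C" "v \<in> C"
  shows "\<exists>i. (f ^^ i) u = v"
proof -
  have "v \<in> Orbits.orbit f u" using orbit_cyclic_eq3[OF assms(1,2)] assms(3) by simp
  then show ?thesis unfolding orbit_altdef by blast
qed

lemma cyclic_on_funpow_image:
  assumes "permutation f" "cyclic_on f C"
  shows "(f ^^ i) ` C = C"
proof -
  have "inj (f ^^ i)"
    using assms(1) by (simp add: bij_is_inj permutation_bijective permutation_funpow)
  moreover have "(f ^^ i) ` C \<subseteq> C"
    using cyclic_on_funpow_in[OF assms(2)] by blast
  ultimately show ?thesis
    using endo_inj_surj[OF finite_cyclic_on[OF assms(2)]] inj_on_subset[OF _ subset_UNIV] by blast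
qed

lemma cyclic_on_invariant_cases:
  assumes "cyclic_on f C" "f ` S \<subseteq> S"
  shows "C \<inter> S = {} \<or> C \<subseteq> S"
proof -
  have "(f ^^ i) u \<in> S" if "u \<in> S" for u i
    using that assms(2) by (induction i) auto
  then show ?thesis using cyclic_on_reach[OF assms(1)] by blast
qed

text \<open>\<open>support f u\<close> lists the cycle through \<open>u\<close>, and \<open>least_power f u\<close> is its
  length.\<close>
lemma cyclic_on_support:
  assumes "permutation f" "cyclic_on f C" "u \<in> C"
  shows "set (support f u) = C" "least_power f u = card C"
proof -
  have "C = Orbits.orbit f u" using orbit_cyclic_eq3[OF assms(2,3)] ..
  also have "\<dots> = range (\<lambda>i. (f ^^ i) u)"
    unfolding orbit_altdef_permutation[OF assms(1)] by blast
  also have "\<dots> = set (support f u)" using support_set[OF assms(1)] ..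
  finally show "set (support f u) = C" ..
  then show "least_power f u = card C"
    using distinct_card[OF cycle_of_permutation[OF assms(1), of u]] by simp
qed

lemma cyclic_on_funpow_fixes_iff:
  assumes "permutation f" "cyclic_on f C" "u \<in> C"
  shows "(f ^^ i) u = u \<longleftrightarrow> card C dvd i"
  using least_power_dvd[OF assms(1), of u i] cyclic_on_support(2)[OF assms] by simp

lemma cyclic_on_funpow_fixes:
  assumes "permutation f" "cyclic_on f C" "u \<in> C" "card C dvd i"
  shows "(f ^^ i) u = u"
  using cyclic_on_funpow_fixes_iff[OF assms(1-3)] assms(4) by simp

text \<open>Exponents coprime to the length are invertible modulo it, so such a power still reaches every
  point of the cycle.\<close>
lemma cyclic_on_funpow:
  assumes "permutation f" "cyclic_on f C" "coprime k (card C)"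
  shows "cyclic_on (f ^^ k) C"
proof -
  obtain u where u: "u \<in> C" "C = Orbits.orbit f u" using assms(2) unfolding cyclic_on_def by blast
  have "v \<in> Orbits.orbit (f ^^ k) u" if v: "v \<in> C" for v
  proof -
    obtain i where i: "(f ^^ i) u = v" using cyclic_on_reach[OF assms(2) u(1) v] by blast
    obtain j where j: "(k * j) mod card C = i mod card C"
    proof (cases "k = 0")
      case True
      then show thesis using assms(3) that by simp
    next
      case False
      then obtain r s where "k * r = card C * s + 1" using bezout_nat[of k "card C"] assms(3) by auto
      then have "k * r * i = (card C * s + 1) * i" by simp
      then have "k * (r * i) = card C * (s * i) + i" by (simp add: algebra_simps)
      then show thesis using that[of "r * i"] by simp
    qed
    have c: "(f ^^ card C) u = u" using cyclic_on_funpow_fixes[OF assms(1,2) u(1)] by simp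
    have "((f ^^ k) ^^ j) u = (f ^^ ((k * j) mod card C)) u"
      using funpow_mod_eq[OF c, of "k * j"] by (simp add: funpow_mult)
    also have "\<dots> = v" using j i funpow_mod_eq[OF c, of i] by simp
    finally show ?thesis
      unfolding orbit_altdef_permutation[OF permutation_funpow[OF assms(1)]] by blast
  qed
  moreover have "Orbits.orbit (f ^^ k) u \<subseteq> C"
    unfolding orbit_altdef_permutation[OF permutation_funpow[OF assms(1)]]
    using cyclic_on_funpow_in[OF assms(2) u(1)] by (auto simp: funpow_mult)
  ultimately show ?thesis using u(1) unfolding cyclic_on_def by blast
qed

lemma cyclic_on_list:
  assumes "permutation f" "cyclic_on f C" "u \<in> C"
  shows "set (map (\<lambda>i. (f ^^ i) u) [0..<card C]) = C" "distinct (map (\<lambda>i. (f ^^ i) u) [0..<card C])"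
  using cyclic_on_support(1)[OF assms] cycle_of_permutation[OF assms(1), of u]
  unfolding cyclic_on_support(2)[OF assms] .

lemma cyclic_on_conj:
  assumes "cyclic_on f C" "bij g"
  shows "cyclic_on (g \<circ> f \<circ> inv' g) (g ` C)"
  using assms by (intro cyclic_on_image[OF assms(1)]) (simp add: bij_is_inj)

lemma cycle_of_list_3:
  assumes "distinct [a, b, c]"
  shows "cycle_of_list [a, b, c] = (\<lambda>x. if x = a then b else if x = b then c else if x = c then a else x)"
  using assms by (intro ext) (auto simp: transpose_def)

text \<open>From here on a 3-cycle is handled through its values rather than as a product of
  transpositions.\<close>
declare cycle_of_list.simps [simp del]

text \<open>Away from \<open>u\<close> the two permutations move disjoint sets of points and cancel in the commutator;
  only \<open>u\<close> and its two images are affected.\<close>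
lemma commutator_eq_three_cycle:
  assumes perm: "\<alpha> permutes A" "\<beta> permutes B" and int: "A \<inter> B = {u}"
    and mv: "\<alpha> u \<noteq> u" "\<beta> u \<noteq> u"
  shows "\<alpha> \<circ> \<beta> \<circ> inv' \<alpha> \<circ> inv' \<beta> = cycle_of_list [u, \<alpha> u, \<beta> u]"
proof -
  have inA: "\<alpha> u \<in> A" "inv' \<alpha> u \<in> A" and inB: "\<beta> u \<in> B" "inv' \<beta> u \<in> B"
    using perm int by (auto simp: permutes_in_image permutes_inv)
  have nin: "inv' \<alpha> u \<noteq> u" "inv' \<beta> u \<noteq> u"
    using mv permutes_inverses(1)[OF perm(1), of u] permutes_inverses(1)[OF perm(2), of u] by auto
  have out: "\<And>x. x \<notin> A \<Longrightarrow> \<alpha> x = x" "\<And>x. x \<notin> A \<Longrightarrow> inv' \<alpha> x = x"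
    "\<And>x. x \<notin> B \<Longrightarrow> \<beta> x = x" "\<And>x. x \<notin> B \<Longrightarrow> inv' \<beta> x = x"
    using perm permutes_inv[OF perm(1)] permutes_inv[OF perm(2)] by (simp_all add: permutes_not_in)
  note inv = permutes_inverses[OF perm(1)] permutes_inverses[OF perm(2)]
  have ab: "\<alpha> u \<notin> B" "inv' \<alpha> u \<notin> B" "\<beta> u \<notin> A" "inv' \<beta> u \<notin> A"
    using inA inB nin mv int by blast+
  have dist: "distinct [u, \<alpha> u, \<beta> u]" using mv inA inB ab by auto
  have "(\<alpha> \<circ> \<beta> \<circ> inv' \<alpha> \<circ> inv' \<beta>) x = cycle_of_list [u, \<alpha> u, \<beta> u] x" for x
  proof -
    consider "x = u" | "x = \<alpha> u" | "x = \<beta> u" | "x \<noteq> u" "x \<noteq> \<alpha> u" "x \<noteq> \<beta> u" by blast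
    then show ?thesis
    proof cases
      case 4
      have "(\<alpha> \<circ> \<beta> \<circ> inv' \<alpha> \<circ> inv' \<beta>) x = x"
      proof (cases "x \<in> B")
        case True
        then have "inv' \<beta> x \<noteq> u" using 4 inv by metis
        moreover have "inv' \<beta> x \<in> B" using True perm by (simp add: permutes_in_image permutes_inv)
        ultimately have "inv' \<beta> x \<notin> A" using int by blast
        moreover have "x \<notin> A" using True int 4 by blast
        ultimately show ?thesis using out inv by simp
      next
        case False
        then have 1: "inv' \<beta> x = x" using out by simp
        have "inv' \<alpha> x \<notin> B"
        proof (cases "x \<in> A")
          case True
          then have "inv' \<alpha> x \<in> A" using perm by (simp add: permutes_in_image permutes_inv)
          moreover have "inv' \<alpha> x \<noteq> u" using 4 inv by metis
          ultimately show ?thesis using int by blast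
        next
          case F: False then show ?thesis using False out by simp
        qed
        then show ?thesis using 1 out inv by simp
      qed
      then show ?thesis using 4 by (simp add: cycle_of_list_3[OF dist] del: cycle_of_list.simps)
    qed (use dist mv out inv ab in \<open>simp_all add: cycle_of_list_3[OF dist] del: cycle_of_list.simps\<close>)
  qed
  then show ?thesis by blast
qed

section \<open>Permutation groups, blocks and primitivity\<close>

text \<open>The points and the group are plain sets, so that images of point sets under group elements and
  products of group elements stay ordinary images and compositions of functions.\<close>
locale permutation_group =
  fixes \<Omega> :: "'a set" and G :: "('a \<Rightarrow> 'a) set"
  assumes finite_points [simp]: "finite \<Omega>"
    and perm: "g \<in> G \<Longrightarrow> g permutes \<Omega>"
    and id_mem: "id \<in> G"
    and comp_mem: "g \<in> G \<Longrightarrow> h \<in> G \<Longrightarrow> g \<circ> h \<in> G"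
    and inv_mem: "g \<in> G \<Longrightarrow> inv' g \<in> G"
begin

definition transitive :: bool where
  "transitive \<longleftrightarrow> (\<forall>u\<in>\<Omega>. \<forall>v\<in>\<Omega>. \<exists>g\<in>G. g u = v)"

definition doubly_transitive :: bool where
  "doubly_transitive \<longleftrightarrow> (\<forall>u\<in>\<Omega>. \<forall>v\<in>\<Omega>. \<forall>u'\<in>\<Omega>. \<forall>v'\<in>\<Omega>.
     u \<noteq> v \<longrightarrow> u' \<noteq> v' \<longrightarrow> (\<exists>g\<in>G. g u = u' \<and> g v = v'))"

definition block :: "'a set \<Rightarrow> bool" where
  "block B \<longleftrightarrow> B \<subseteq> \<Omega> \<and> B \<noteq> {} \<and> (\<forall>g\<in>G. g ` B = B \<or> g ` B \<inter> B = {})"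

definition primitive :: bool where
  "primitive \<longleftrightarrow> transitive \<and> (\<forall>B. block B \<longrightarrow> card B = 1 \<or> B = \<Omega>)"

text \<open>The points outside \<open>\<Omega>\<close> are fixed by every group element, so this says that the support of \<open>g\<close>
  lies in \<open>X\<close>.\<close>
definition fixes_outside :: "('a \<Rightarrow> 'a) \<Rightarrow> 'a set \<Rightarrow> bool" where
  "fixes_outside g X \<longleftrightarrow> (\<forall>w\<in>\<Omega> - X. g w = w)"

definition all_three_cycles :: bool where
  "all_three_cycles \<longleftrightarrow> (\<forall>a\<in>\<Omega>. \<forall>b\<in>\<Omega>. \<forall>c\<in>\<Omega>. distinct [a, b, c] \<longrightarrow> cycle_of_list [a, b, c] \<in> G)"

lemma permutation_mem: "g \<in> G \<Longrightarrow> permutation g"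
  using perm permutation_permutes finite_points by blast

lemma bij_mem: "g \<in> G \<Longrightarrow> bij g"
  using perm permutes_bij by blast

lemma inj_mem: "g \<in> G \<Longrightarrow> inj g"
  using bij_mem bij_is_inj by blast

lemma mem_in [simp]: "g \<in> G \<Longrightarrow> g u \<in> \<Omega> \<longleftrightarrow> u \<in> \<Omega>"
  using perm permutes_in_image by metis

lemma inv_app [simp]: "g \<in> G \<Longrightarrow> inv' g (g u) = u" "g \<in> G \<Longrightarrow> g (inv' g u) = u"
  using perm permutes_inverses by metis+

lemma image_subset: "g \<in> G \<Longrightarrow> X \<subseteq> \<Omega> \<Longrightarrow> g ` X \<subseteq> \<Omega>"
  by auto

lemma image_all: "g \<in> G \<Longrightarrow> g ` \<Omega> = \<Omega>"
  using perm permutes_image by blast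

lemma card_image_mem: "g \<in> G \<Longrightarrow> card (g ` X) = card X"
  using inj_mem card_image inj_on_subset subset_UNIV by metis

lemma funpow_mem: "g \<in> G \<Longrightarrow> g ^^ i \<in> G"
  by (induction i) (auto simp: id_mem comp_mem)

lemma inv_image: "g \<in> G \<Longrightarrow> inv' g ` g ` X = X"
  by (simp add: image_image)

lemma image_inv: "g \<in> G \<Longrightarrow> g ` inv' g ` X = X"
  by (simp add: image_image)

lemma image_Int_mem: "g \<in> G \<Longrightarrow> g ` (X \<inter> Y) = g ` X \<inter> g ` Y"
  using inj_mem image_Int by blast

lemma image_Diff_mem: "g \<in> G \<Longrightarrow> g ` (\<Omega> - X) = \<Omega> - g ` X"
  using image_set_diff[OF inj_mem] image_all by metis

lemma transitiveD: "transitive \<Longrightarrow> u \<in> \<Omega> \<Longrightarrow> v \<in> \<Omega> \<Longrightarrow> \<exists>g\<in>G. g u = v"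
  unfolding transitive_def by blast

lemma primitive_imp_transitive: "primitive \<Longrightarrow> transitive"
  unfolding primitive_def by blast

lemma conj_mem: "g \<in> G \<Longrightarrow> f \<in> G \<Longrightarrow> g \<circ> f \<circ> inv' g \<in> G"
  by (simp add: comp_mem inv_mem)

lemma fixes_outside_conj:
  assumes "g \<in> G" "fixes_outside f X"
  shows "fixes_outside (g \<circ> f \<circ> inv' g) (g ` X)"
proof -
  have "f (inv' g w) = inv' g w" if w: "w \<in> \<Omega>" "w \<notin> g ` X" for w
  proof -
    have "inv' g w \<notin> X" using w(2) inv_app(2)[OF assms(1), of w] by (metis image_eqI)
    moreover have "inv' g w \<in> \<Omega>" using w(1) inv_mem[OF assms(1)] by simp
    ultimately show ?thesis using assms(2) unfolding fixes_outside_def by blast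
  qed
  then show ?thesis unfolding fixes_outside_def using assms(1) by simp
qed

lemma fixes_outside_funpow: "fixes_outside f X \<Longrightarrow> fixes_outside (f ^^ i) X"
  unfolding fixes_outside_def by (induction i) auto

lemma permutes_of_fixes_outside:
  assumes "g \<in> G" "fixes_outside g X"
  shows "g permutes X"
  using permutes_superset[OF perm[OF assms(1)]] assms(2) unfolding fixes_outside_def by blast

lemma cyclic_conj_mem:
  assumes "g \<in> G" "z \<in> G" "cyclic_on z X" "fixes_outside z X"
  obtains z' where "z' \<in> G" "cyclic_on z' (g ` X)" "fixes_outside z' (g ` X)"
  using conj_mem[OF assms(1,2)] cyclic_on_conj[OF assms(3) bij_mem[OF assms(1)]]
    fixes_outside_conj[OF assms(1,4)] by blast

lemma block_translates:
  assumes "block B" "g \<in> G" "h \<in> G"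
  shows "g ` B = h ` B \<or> g ` B \<inter> h ` B = {}"
proof -
  have e: "(inv' h \<circ> g) ` B = inv' h ` g ` B" by (rule image_comp [symmetric])
  have k: "inv' h \<circ> g \<in> G" using assms by (simp add: comp_mem inv_mem)
  consider "inv' h ` g ` B = B" | "inv' h ` g ` B \<inter> B = {}"
    using assms(1) k e unfolding block_def by metis
  then show ?thesis
  proof cases
    case 1
    then show ?thesis using image_inv[OF assms(3), of "g ` B"] by metis
  next
    case 2
    then have "h ` (inv' h ` g ` B) \<inter> h ` B = {}" using image_Int_mem[OF assms(3)] by (metis image_empty)
    then show ?thesis using image_inv[OF assms(3)] by metis
  qed
qed

text \<open>The translates of a block are pairwise disjoint, of equal size, and cover all points; those that
  meet \<open>C\<close> partition it.\<close>
lemma block_card_dvd: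
  assumes tr: "transitive" and B: "block B" and C: "C \<subseteq> \<Omega>"
    and sub: "\<And>g. g \<in> G \<Longrightarrow> g ` B \<inter> C \<noteq> {} \<Longrightarrow> g ` B \<subseteq> C"
  shows "card B dvd card C"
proof -
  define P where "P = {g ` B |g. g \<in> G \<and> g ` B \<inter> C \<noteq> {}}"
  have BO: "B \<subseteq> \<Omega>" "B \<noteq> {}" using B unfolding block_def by auto
  have U: "\<Union>P = C"
  proof
    show "\<Union>P \<subseteq> C" unfolding P_def using sub by blast
    show "C \<subseteq> \<Union>P"
    proof
      fix v assume v: "v \<in> C"
      obtain u where u: "u \<in> B" using BO by blast
      obtain g where g: "g \<in> G" "g u = v" using transitiveD[OF tr, of u v] u v BO C by blast
      then have "v \<in> g ` B" using u by blast
      then show "v \<in> \<Union>P" unfolding P_def using g v by blast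
    qed
  qed
  have "P \<subseteq> Pow C" using U by blast
  then have fP: "finite P" using C finite_subset[OF _ finite_points] finite_subset finite_Pow_iff by metis
  have "card B * card P = card (\<Union>P)"
  proof (rule card_partition[OF fP])
    show "finite (\<Union>P)" using U C finite_subset[OF _ finite_points] by blast
    show "card c = card B" if "c \<in> P" for c using that card_image_mem unfolding P_def by blast
    show "c1 \<inter> c2 = {}" if "c1 \<in> P" "c2 \<in> P" "c1 \<noteq> c2" for c1 c2
      using that block_translates[OF B] unfolding P_def by blast
  qed
  then show ?thesis using U by (metis dvd_triv_left)
qed

lemma block_card_dvd_all:
  assumes "transitive" "block B"
  shows "card B dvd card \<Omega>"
  using block_card_dvd[OF assms subset_refl] image_subset assms(2) unfolding block_def by blast

lemma primitive_of_prime_degree: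
  assumes tr: "transitive" and "prime (card \<Omega>)"
  shows "primitive"
  unfolding primitive_def
proof (intro conjI allI impI)
  fix B assume B: "block B"
  then have "B \<subseteq> \<Omega>" unfolding block_def by blast
  moreover have "card B = 1 \<or> card B = card \<Omega>"
    using block_card_dvd_all[OF tr B] assms(2) by (simp add: prime_nat_iff)
  ultimately show "card B = 1 \<or> B = \<Omega>" using card_subset_eq[OF finite_points] by blast
qed (rule tr)

text \<open>A block containing a fixed point of \<open>c\<close> is mapped to itself by \<open>c\<close>, hence contains \<open>\<Gamma>\<close> or misses
  it. The first is impossible for a proper block, which has at most half of the points. So the
  complement of \<open>\<Gamma>\<close> is a union of blocks, and its size being coprime to that of \<open>\<Omega>\<close> leaves only
  blocks of size 1.\<close>
lemma primitive_of_long_cycle: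
  assumes tr: "transitive" and c: "c \<in> G" "cyclic_on c \<Gamma>" "fixes_outside c \<Gamma>" and sub: "\<Gamma> \<subseteq> \<Omega>"
    and big: "card \<Omega> < 2 * card \<Gamma>" and cop: "coprime (card (\<Omega> - \<Gamma>)) (card \<Omega>)"
  shows "primitive"
  unfolding primitive_def
proof (intro conjI allI impI)
  fix B assume B: "block B"
  show "card B = 1 \<or> B = \<Omega>"
  proof (rule disjCI)
    assume ne: "B \<noteq> \<Omega>"
    have BO: "B \<subseteq> \<Omega>" using B unfolding block_def by blast
    obtain k where k: "card \<Omega> = card B * k" using block_card_dvd_all[OF tr B] by blast
    have "card B < card \<Omega>" using BO ne psubset_card_mono[OF finite_points] by blast
    then have "k \<noteq> 0" "k \<noteq> 1" using k by auto
    then have half: "2 * card B \<le> card \<Omega>" using k by (cases k; cases "k - 1") auto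
    have "card B dvd card (\<Omega> - \<Gamma>)"
    proof (rule block_card_dvd[OF tr B])
      fix g assume g: "g \<in> G" and meet: "g ` B \<inter> (\<Omega> - \<Gamma>) \<noteq> {}"
      then obtain u where u: "u \<in> g ` B" "u \<in> \<Omega>" "u \<notin> \<Gamma>" by blast
      have "c u = u" using c(3) u unfolding fixes_outside_def by blast
      then have "u \<in> c ` g ` B" using u(1) by (metis image_eqI)
      then have "c ` g ` B = g ` B"
        using block_translates[OF B comp_mem[OF c(1) g] g] u(1) by (auto simp: image_comp)
      then consider "\<Gamma> \<inter> g ` B = {}" | "\<Gamma> \<subseteq> g ` B"
        using cyclic_on_invariant_cases[OF c(2), of "g ` B"] by blast
      then show "g ` B \<subseteq> \<Omega> - \<Gamma>"
      proof cases
        case 1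
        then show ?thesis using image_subset[OF g BO] by blast
      next
        case 2
        have "finite (g ` B)" using finite_subset[OF image_subset[OF g BO] finite_points] .
        then have "card \<Gamma> \<le> card B" using card_mono[OF _ 2] card_image_mem[OF g] by metis
        then show ?thesis using half big by linarith
      qed
    qed blast
    then have "card B dvd 1" using cop block_card_dvd_all[OF tr B] coprime_common_divisor by blast
    then show "card B = 1" by simp
  qed
qed (rule tr)

subsection \<open>Jordan sets and double transitivity\<close>

text \<open>A Jordan set: the pointwise stabilizer of its complement acts transitively on it.\<close>
definition jordan_set :: "'a set \<Rightarrow> bool" where
  "jordan_set X \<longleftrightarrow> (\<forall>u\<in>X. \<forall>v\<in>X. \<exists>g\<in>G. fixes_outside g X \<and> g u = v)"

lemma jordan_set_of_cycle:
  assumes "c \<in> G" "cyclic_on c \<Gamma>" "fixes_outside c \<Gamma>"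
  shows "jordan_set \<Gamma>"
  unfolding jordan_set_def
proof (intro ballI)
  fix u v assume "u \<in> \<Gamma>" "v \<in> \<Gamma>"
  then obtain i where "(c ^^ i) u = v" using cyclic_on_reach[OF assms(2)] by blast
  then show "\<exists>g\<in>G. fixes_outside g \<Gamma> \<and> g u = v"
    using funpow_mem[OF assms(1)] fixes_outside_funpow[OF assms(3)] by blast
qed

text \<open>Every point of the union can be moved to a fixed common point, inside one of the two sets.\<close>
lemma jordan_set_Un:
  assumes "jordan_set X" "jordan_set Y" "X \<inter> Y \<noteq> {}"
  shows "jordan_set (X \<union> Y)"
proof -
  obtain w where w: "w \<in> X" "w \<in> Y" using assms(3) by blast
  have to_w: "\<exists>g\<in>G. fixes_outside g (X \<union> Y) \<and> g u = w" if "u \<in> X \<union> Y" for u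
    using that assms(1,2) w unfolding jordan_set_def fixes_outside_def by blast
  have from_w: "\<exists>g\<in>G. fixes_outside g (X \<union> Y) \<and> g w = v" if "v \<in> X \<union> Y" for v
    using that assms(1,2) w unfolding jordan_set_def fixes_outside_def by blast
  show ?thesis unfolding jordan_set_def
  proof (intro ballI)
    fix u v assume "u \<in> X \<union> Y" "v \<in> X \<union> Y"
    then obtain g h where g: "g \<in> G" "fixes_outside g (X \<union> Y)" "g u = w"
      and h: "h \<in> G" "fixes_outside h (X \<union> Y)" "h w = v" using to_w from_w by metis
    have "fixes_outside (h \<circ> g) (X \<union> Y)" using g(2) h(2) unfolding fixes_outside_def by simp
    then show "\<exists>k\<in>G. fixes_outside k (X \<union> Y) \<and> k u = v"
      using g h comp_mem by (metis comp_apply)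
  qed
qed

lemma jordan_set_translate:
  assumes "jordan_set X" "g \<in> G"
  shows "jordan_set (g ` X)"
  unfolding jordan_set_def
proof (intro ballI)
  fix u v assume "u \<in> g ` X" "v \<in> g ` X"
  then obtain u' v' where *: "u = g u'" "v = g v'" "u' \<in> X" "v' \<in> X" by blast
  then obtain h where h: "h \<in> G" "fixes_outside h X" "h u' = v'"
    using assms(1) unfolding jordan_set_def by blast
  have "(g \<circ> h \<circ> inv' g) u = v" using * h assms(2) by simp
  then show "\<exists>k\<in>G. fixes_outside k (g ` X) \<and> k u = v"
    using conj_mem[OF assms(2) h(1)] fixes_outside_conj[OF assms(2) h(2)] by blast
qed

text \<open>Pairs are compared after moving their first points to \<open>\<delta>\<close>, whose stabilizer acts transitively on
  the other points.\<close>
lemma doubly_transitive_of_point_stabilizer: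
  assumes tr: "transitive" and "\<delta> \<in> \<Omega>" and J: "jordan_set (\<Omega> - {\<delta>})"
  shows "doubly_transitive"
  unfolding doubly_transitive_def
proof (intro ballI impI)
  fix u v u' v' assume *: "u \<in> \<Omega>" "v \<in> \<Omega>" "u' \<in> \<Omega>" "v' \<in> \<Omega>" "u \<noteq> v" "u' \<noteq> v'"
  obtain g where g: "g \<in> G" "g u = \<delta>" using transitiveD[OF tr] * assms(2) by blast
  obtain h where h: "h \<in> G" "h u' = \<delta>" using transitiveD[OF tr] * assms(2) by blast
  have "g v \<noteq> \<delta>" "h v' \<noteq> \<delta>" using g h * inv_app(1) by metis+
  then have "g v \<in> \<Omega> - {\<delta>}" "h v' \<in> \<Omega> - {\<delta>}" using g h * by auto
  then obtain k where k: "k \<in> G" "fixes_outside k (\<Omega> - {\<delta>})" "k (g v) = h v'"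
    using J unfolding jordan_set_def by blast
  have kd: "k \<delta> = \<delta>" using k(2) assms(2) unfolding fixes_outside_def by blast
  have "(inv' h \<circ> (k \<circ> g)) u = u'" using kd g h inv_app(1)[OF h(1), of u'] by simp
  moreover have "(inv' h \<circ> (k \<circ> g)) v = v'" using k h by simp
  ultimately show "\<exists>g\<in>G. g u = u' \<and> g v = v'" using comp_mem inv_mem g h k by blast
qed

text \<open>Consider complements of Jordan sets that have fewer than half of the points, such as the fixed
  point set of \<open>c\<close>. Two large Jordan sets intersect, so their union is a Jordan set; in other words
  this family of complements is closed under nonempty intersections of translates. A smallest member
  is therefore a block, hence a single point in a primitive group.\<close>
lemma doubly_transitive_of_long_cycle:
  assumes pr: "primitive" and c: "c \<in> G" "cyclic_on c \<Gamma>" "fixes_outside c \<Gamma>"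
    and sub: "\<Gamma> \<subset> \<Omega>" and big: "card \<Omega> < 2 * card \<Gamma>"
  shows "doubly_transitive"
proof -
  define \<X> where "\<X> = {X. X \<noteq> {} \<and> X \<subseteq> \<Omega> \<and> jordan_set (\<Omega> - X) \<and> 2 * card X < card \<Omega>}"
  have fin: "finite X" if "X \<subseteq> \<Omega>" for X using that finite_subset finite_points by blast
  have "card (\<Omega> - \<Gamma>) = card \<Omega> - card \<Gamma>" using sub fin[of \<Gamma>] by (simp add: card_Diff_subset)
  moreover have "\<Omega> - (\<Omega> - \<Gamma>) = \<Gamma>" using sub by blast
  moreover have "card \<Gamma> \<le> card \<Omega>" using sub card_mono[OF finite_points] by blast
  ultimately have "\<Omega> - \<Gamma> \<in> \<X>"
    unfolding \<X>_def using sub big jordan_set_of_cycle[OF c] by auto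
  then obtain X where X: "X \<in> \<X>" and mini: "\<And>Y. Y \<in> \<X> \<Longrightarrow> card X \<le> card Y"
    using ex_has_least_nat[of "\<lambda>X. X \<in> \<X>" _ card] by blast
  have X': "X \<noteq> {}" "X \<subseteq> \<Omega>" "jordan_set (\<Omega> - X)" "2 * card X < card \<Omega>"
    using X unfolding \<X>_def by auto
  have "block X" unfolding block_def
  proof (intro conjI ballI)
    fix g assume g: "g \<in> G"
    show "g ` X = X \<or> g ` X \<inter> X = {}"
    proof (rule disjCI)
      assume ne: "g ` X \<inter> X \<noteq> {}"
      have J: "jordan_set (\<Omega> - g ` X)" using jordan_set_translate[OF X'(3) g] image_Diff_mem[OF g] by simp
      have "(\<Omega> - g ` X) \<inter> (\<Omega> - X) \<noteq> {}"
      proof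
        assume "(\<Omega> - g ` X) \<inter> (\<Omega> - X) = {}"
        then have "\<Omega> \<subseteq> g ` X \<union> X" by blast
        then have "card \<Omega> \<le> card (g ` X \<union> X)" using fin[OF X'(2)] by (intro card_mono) auto
        then show False using card_Un_le[of "g ` X" X] card_image_mem[OF g, of X] X'(4) by linarith
      qed
      then have "jordan_set ((\<Omega> - g ` X) \<union> (\<Omega> - X))" by (rule jordan_set_Un[OF J X'(3)])
      moreover have "(\<Omega> - g ` X) \<union> (\<Omega> - X) = \<Omega> - (g ` X \<inter> X)" by blast
      moreover have le: "card (g ` X \<inter> X) \<le> card X" using fin[OF X'(2)] by (intro card_mono) auto
      ultimately have "g ` X \<inter> X \<in> \<X>" unfolding \<X>_def using ne X' by auto
      then have "card (g ` X \<inter> X) = card X" using mini le by (simp add: le_antisym)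
      then have "g ` X \<inter> X = X" using card_subset_eq[OF fin[OF X'(2)]] by blast
      moreover have "card (g ` X) = card X" using card_image_mem[OF g] .
      ultimately show "g ` X = X" using fin[OF X'(2)] card_subset_eq[of "g ` X" X]
        by (metis Int_lower1 finite_imageI)
    qed
  qed (use X' in auto)
  then have "card X = 1 \<or> X = \<Omega>" using pr unfolding primitive_def by blast
  then obtain \<delta> where "X = {\<delta>}" using X'(4) card_1_singletonE by auto
  then show ?thesis
    using doubly_transitive_of_point_stabilizer[OF primitive_imp_transitive[OF pr], of \<delta>] X' by simp
qed

text \<open>Let \<open>a\<close> and \<open>b\<close> be points other than \<open>\<delta>\<close>. Of the elements of the stabilizer of \<open>\<delta>\<close>, a fraction
  of exactly \<open>1 / (card \<Omega> - 1)\<close> maps \<open>a\<close> to \<open>b\<close>. If each element mapped some point of \<open>A\<close> other than \<open>\<delta>\<close> to such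
  a point again, the \<open>(card A - 1)\<^sup>2\<close> pairs would cover the stabilizer, and they are too few for that.\<close>
lemma exists_translate_meeting_in_point:
  assumes dt: "doubly_transitive" and A: "A \<subseteq> \<Omega>" "\<delta> \<in> A" and small: "(card A - 1)\<^sup>2 < card \<Omega> - 1"
  shows "\<exists>g\<in>G. g \<delta> = \<delta> \<and> g ` A \<inter> A = {\<delta>}"
proof (rule ccontr)
  assume no: "\<not> ?thesis"
  define S where "S = {g \<in> G. g \<delta> = \<delta>}"
  define N where "N a b = {g \<in> S. g a = b}" for a b
  have \<delta>: "\<delta> \<in> \<Omega>" using A by blast
  have finA: "finite A" using A finite_subset finite_points by blast
  have "S \<subseteq> {p. p permutes \<Omega>}" unfolding S_def using perm by blast
  then have finS: "finite S" using finite_permutations[OF finite_points] finite_subset by blast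
  have idS: "id \<in> S" unfolding S_def using id_mem by simp
  have Npos: "card S > 0" using finS idS card_gt_0_iff by blast
  have Neq: "card (N a b) \<le> card (N a b')" if ab: "b \<in> \<Omega> - {\<delta>}" "b' \<in> \<Omega> - {\<delta>}" for a b b'
  proof -
    obtain k where k: "k \<in> G" "k \<delta> = \<delta>" "k b = b'"
      using dt ab \<delta> unfolding doubly_transitive_def by (metis DiffE singletonI)
    have "inj_on (\<lambda>g. k \<circ> g) (N a b)"
      using inj_mem[OF k(1)] by (intro inj_onI) (metis fun.inj_map injD)
    moreover have "(\<lambda>g. k \<circ> g) ` N a b \<subseteq> N a b'"
      unfolding N_def S_def using k comp_mem by auto
    moreover have "finite (N a b')" unfolding N_def using finS by simp
    ultimately show ?thesis by (rule card_inj_on_le)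
  qed
  have count: "(card \<Omega> - 1) * card (N a b) = card S" if ab: "a \<in> \<Omega> - {\<delta>}" "b \<in> \<Omega> - {\<delta>}" for a b
  proof -
    have "S = (\<Union>b'\<in>\<Omega> - {\<delta>}. N a b')"
    proof -
      have "g a \<in> \<Omega> - {\<delta>}" if "g \<in> S" for g
        using that ab inj_mem[of g] unfolding S_def inj_def by auto
      then show ?thesis unfolding N_def by auto
    qed
    then have "card S = card (\<Union>b'\<in>\<Omega> - {\<delta>}. N a b')" by simp
    also have "\<dots> = (\<Sum>b'\<in>\<Omega> - {\<delta>}. card (N a b'))"
      by (rule card_UN_disjoint) (auto simp: N_def finS)
    also have "\<dots> = (\<Sum>b'\<in>\<Omega> - {\<delta>}. card (N a b))"
      using Neq ab by (intro sum.cong refl le_antisym) auto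
    also have "\<dots> = (card \<Omega> - 1) * card (N a b)" using \<delta> by simp
    finally show ?thesis by simp
  qed
  define A' where "A' = A - {\<delta>}"
  have cA: "card A' = card A - 1" unfolding A'_def using A finA by simp
  have sub: "S \<subseteq> (\<Union>(a, b)\<in>A' \<times> A'. N a b)"
  proof
    fix g assume g: "g \<in> S"
    then have gG: "g \<in> G" "g \<delta> = \<delta>" unfolding S_def by auto
    then have "\<delta> \<in> g ` A \<inter> A" using A by (metis IntI image_eqI)
    then obtain b where b: "b \<in> g ` A" "b \<in> A" "b \<noteq> \<delta>" using no gG by blast
    then obtain a where a: "a \<in> A" "b = g a" by blast
    then have "a \<noteq> \<delta>" using b gG by blast
    then show "g \<in> (\<Union>(a, b)\<in>A' \<times> A'. N a b)" using a b g unfolding A'_def N_def by blast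
  qed
  have finA': "finite (A' \<times> A')" unfolding A'_def using finA by blast
  have "card S \<le> card (\<Union>(a, b)\<in>A' \<times> A'. N a b)"
    using sub by (intro card_mono finite_UN_I[OF finA']) (auto simp: N_def finS)
  also have "\<dots> \<le> (\<Sum>(a, b)\<in>A' \<times> A'. card (N a b))"
    using card_UN_le[OF finA', of "\<lambda>(a, b). N a b"] by (simp add: case_prod_unfold)
  finally have le: "card S \<le> (\<Sum>(a, b)\<in>A' \<times> A'. card (N a b))" .
  have "(card \<Omega> - 1) * card S \<le> (card \<Omega> - 1) * (\<Sum>(a, b)\<in>A' \<times> A'. card (N a b))"
    using le by simp
  also have "\<dots> = (\<Sum>(a, b)\<in>A' \<times> A'. (card \<Omega> - 1) * card (N a b))"
    by (simp add: sum_distrib_left case_prod_unfold)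
  also have "\<dots> = (\<Sum>(a, b)\<in>A' \<times> A'. card S)"
    using count A unfolding A'_def by (intro sum.cong refl) (auto simp: subset_iff)
  also have "\<dots> = (card A - 1)\<^sup>2 * card S"
    by (simp add: card_cartesian_product cA power2_eq_square case_prod_unfold)
  finally show False using small Npos by simp
qed

end

section \<open>From one three-cycle to all of them\<close>

context permutation_group
begin

text \<open>Conjugation gives, for any \<open>u\<close> and \<open>v\<close>, some 3-cycle starting with them. To control the third
  point \<open>t\<close>, take one 3-cycle through \<open>u\<close>, \<open>v\<close> and one through \<open>u\<close>, \<open>t\<close>. If they share only \<open>u\<close>,
  their commutator is the wanted 3-cycle; otherwise one of them already is, up to inversion, or
  conjugates the other into it.\<close>
lemma all_three_cycles_of_doubly_transitive:
  assumes dt: "doubly_transitive" and abc: "a \<in> \<Omega>" "b \<in> \<Omega>" "distinct [a, b, c]"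
    and mem: "cycle_of_list [a, b, c] \<in> G"
  shows "all_three_cycles"
proof -
  define T where "T u v w \<longleftrightarrow> distinct [u, v, w] \<and> cycle_of_list [u, v, w] \<in> G" for u v w
  have dist: "distinct [u, v, w]" if "T u v w" for u v w using that unfolding T_def by blast
  have rot: "T v w u" if "T u v w" for u v w
  proof -
    have d: "distinct [u, v, w]" "distinct [v, w, u]" using dist[OF that] by auto
    have "cycle_of_list [v, w, u] = cycle_of_list [u, v, w]"
      unfolding cycle_of_list_3[OF d(1)] cycle_of_list_3[OF d(2)] using d by (intro ext) auto
    then show ?thesis using that d unfolding T_def by simp
  qed
  have flip: "T u w v" if "T u v w" for u v w
  proof -
    have d: "distinct [u, v, w]" "distinct [u, w, v]" using dist[OF that] by auto
    have "cycle_of_list [u, w, v] = cycle_of_list [u, v, w] \<circ> cycle_of_list [u, v, w]"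
      unfolding cycle_of_list_3[OF d(1)] cycle_of_list_3[OF d(2)] using d by (intro ext) auto
    then show ?thesis using that d comp_mem unfolding T_def by simp
  qed
  have conj: "T (g u) (g v) (g w)" if "g \<in> G" "T u v w" for g u v w
  proof -
    have "cycle_of_list [g u, g v, g w] = g \<circ> cycle_of_list [u, v, w] \<circ> inv' g"
      using conjugation_of_cycle[OF dist[OF that(2)] bij_mem[OF that(1)]] by simp
    moreover have "distinct [g u, g v, g w]"
      using dist[OF that(2)] inj_mem[OF that(1)] by (auto dest: injD)
    ultimately show ?thesis using conj_mem[OF that(1)] that(2) unfolding T_def by simp
  qed
  have ex: "\<exists>w. T u v w" if uv: "u \<in> \<Omega>" "v \<in> \<Omega>" "u \<noteq> v" for u v
  proof -
    obtain g where "g \<in> G" "g a = u" "g b = v"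
      using dt[unfolded doubly_transitive_def, rule_format, of a b u v] uv abc by auto
    then have "T u v (g c)" using conj[of g a b c] mem abc(3) unfolding T_def by simp
    then show ?thesis ..
  qed
  have "T u v t" if uvt: "u \<in> \<Omega>" "v \<in> \<Omega>" "t \<in> \<Omega>" "u \<noteq> v" "u \<noteq> t" "v \<noteq> t" for u v t
  proof -
    obtain w where w: "T u v w" using ex[of u v] uvt by blast
    obtain s where s: "T u t s" using ex[of u t] uvt by blast
    consider "w = t" | "s = v" | "w \<noteq> t" "s = w" | "w \<noteq> t" "s \<noteq> v" "s \<noteq> w" by blast
    then show ?thesis
    proof cases
      case 1 then show ?thesis using w by simp
    next
      case 2 then show ?thesis using s flip by simp
    next
      case 3
      have "T (cycle_of_list [u, t, w] u) (cycle_of_list [u, t, w] v) (cycle_of_list [u, t, w] w)"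
        using conj[OF _ w, of "cycle_of_list [u, t, w]"] s 3 unfolding T_def by simp
      moreover have "cycle_of_list [u, t, w] u = t" "cycle_of_list [u, t, w] v = v"
        "cycle_of_list [u, t, w] w = u"
        using dist[OF w] dist[OF s] uvt 3 cycle_of_list_3[of u t w] by auto
      ultimately have "T t v u" by simp
      then show ?thesis using rot flip by blast
    next
      case 4
      have d: "distinct [u, v, w]" "distinct [u, t, s]" using w s dist by blast+
      have "cycle_of_list [u, v, w] permutes {u, v, w}" "cycle_of_list [u, t, s] permutes {u, t, s}"
        using cycle_permutes[of "[u, v, w]"] cycle_permutes[of "[u, t, s]"] by simp_all
      moreover have "{u, v, w} \<inter> {u, t, s} = {u}" using d uvt 4 by auto
      moreover have e: "cycle_of_list [u, v, w] u = v" "cycle_of_list [u, t, s] u = t"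
        using cycle_of_list_3[OF d(1)] cycle_of_list_3[OF d(2)] by simp_all
      ultimately have eq: "cycle_of_list [u, v, w] \<circ> cycle_of_list [u, t, s] \<circ> inv' (cycle_of_list [u, v, w])
          \<circ> inv' (cycle_of_list [u, t, s]) = cycle_of_list [u, v, t]"
        using commutator_eq_three_cycle[of "cycle_of_list [u, v, w]" "{u, v, w}" "cycle_of_list [u, t, s]" "{u, t, s}" u]
          uvt by simp
      have "cycle_of_list [u, v, w] \<in> G" "cycle_of_list [u, t, s] \<in> G" using w s unfolding T_def by blast+
      then have "cycle_of_list [u, v, t] \<in> G" unfolding eq [symmetric] by (intro comp_mem inv_mem)
      then show ?thesis using uvt unfolding T_def by simp
    qed
  qed
  then show ?thesis unfolding all_three_cycles_def T_def by simp
qed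

lemma three_cycle_of_supports_meeting_in_point:
  assumes "\<alpha> \<in> G" "fixes_outside \<alpha> A" "\<beta> \<in> G" "fixes_outside \<beta> B" "A \<inter> B = {u}"
    and "\<alpha> u \<noteq> u" "\<beta> u \<noteq> u"
  shows "cycle_of_list [u, \<alpha> u, \<beta> u] \<in> G" and "distinct [u, \<alpha> u, \<beta> u]"
proof -
  have p: "\<alpha> permutes A" "\<beta> permutes B" using permutes_of_fixes_outside assms by blast+
  have "\<alpha> \<circ> \<beta> \<circ> inv' \<alpha> \<circ> inv' \<beta> \<in> G" using assms(1,3) by (intro comp_mem inv_mem)
  then show "cycle_of_list [u, \<alpha> u, \<beta> u] \<in> G"
    using commutator_eq_three_cycle[OF p assms(5-7)] by simp
  have "\<alpha> u \<in> A" "\<beta> u \<in> B" using p assms(5) by (auto simp: permutes_in_image)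
  have "\<alpha> u \<noteq> \<beta> u"
  proof
    assume "\<alpha> u = \<beta> u"
    then have "\<alpha> u \<in> A \<inter> B" using \<open>\<alpha> u \<in> A\<close> \<open>\<beta> u \<in> B\<close> by simp
    then show False using assms(5,6) by simp
  qed
  then show "distinct [u, \<alpha> u, \<beta> u]" using assms(6,7) by auto
qed

text \<open>The translating element may be taken to fix \<open>\<delta>\<close>, so that \<open>\<delta>\<close> is moved both by \<open>z\<close> and by its
  conjugate and the commutator of the two is a genuine 3-cycle.\<close>
lemma all_three_cycles_of_small_support:
  assumes dt: "doubly_transitive" and z: "z \<in> G" "fixes_outside z A" and A: "A \<subseteq> \<Omega>"
    and \<delta>: "\<delta> \<in> A" "z \<delta> \<noteq> \<delta>" and small: "(card A - 1)\<^sup>2 < card \<Omega> - 1"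
  shows "all_three_cycles"
proof -
  obtain g where g: "g \<in> G" "g \<delta> = \<delta>" "g ` A \<inter> A = {\<delta>}"
    using exists_translate_meeting_in_point[OF dt A \<delta>(1) small] by blast
  define \<beta> where "\<beta> = g \<circ> z \<circ> inv' g"
  have \<beta>: "\<beta> \<in> G" "fixes_outside \<beta> (g ` A)"
    unfolding \<beta>_def using conj_mem g z fixes_outside_conj by blast+
  have "inv' g \<delta> = \<delta>" using inv_app(1)[OF g(1), of \<delta>] g(2) by simp
  then have "\<beta> \<delta> = g (z \<delta>)" unfolding \<beta>_def by simp
  then have "\<beta> \<delta> \<noteq> \<delta>" using g(2) \<delta>(2) inv_app(1)[OF g(1)] by metis
  moreover have "A \<inter> g ` A = {\<delta>}" using g(3) by blast
  ultimately have "cycle_of_list [\<delta>, z \<delta>, \<beta> \<delta>] \<in> G" "distinct [\<delta>, z \<delta>, \<beta> \<delta>]"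
    using three_cycle_of_supports_meeting_in_point[OF z \<beta>, of \<delta>] \<delta>(2) by simp_all
  moreover have "\<delta> \<in> \<Omega>" "z \<delta> \<in> \<Omega>" using \<delta> A z(1) by auto
  ultimately show ?thesis
    using all_three_cycles_of_doubly_transitive[OF dt, of \<delta> "z \<delta>" "\<beta> \<delta>"] by simp
qed

end

section \<open>Primitive groups containing a cycle of prime length\<close>

text \<open>Write \<open>q\<close> and \<open>k\<close> for the sizes of \<open>A\<close> and \<open>D\<close>. The \<open>q - 1\<close> nontrivial powers of \<open>z\<close> produce
  overlaps of \<open>D\<close> with its translates of total size \<open>k (k - 1)\<close>, since each ordered pair of distinct
  points of \<open>D\<close> is realised by one power. If every overlap were at most \<open>2 k - q\<close>, it would follow
  that \<open>k (k - 1) \<le> (q - 1) (2 k - q)\<close>, which rearranges to \<open>(q - k)\<^sup>2 \<le> q - k\<close> and contradicts \<open>q - k \<ge> 2\<close>. The bound is used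
  to enlarge the intersection of two conjugate supports.\<close>
lemma cyclic_on_prime_overlap:
  assumes z: "permutation z" "cyclic_on z A" and q: "prime (card A)"
    and D: "D \<subseteq> A" and gap: "card D + 2 \<le> card A"
  shows "\<exists>i. \<not> card A dvd i \<and> 2 * card D < card A + card (D \<inter> (z ^^ i) ` D)"
proof (rule ccontr)
  assume no: "\<not> ?thesis"
  define q where "q = card A"
  define k where "k = card D"
  define F where "F i = {a \<in> D. (z ^^ i) a \<in> D}" for i
  have finD: "finite D" using D finite_cyclic_on[OF z(2)] finite_subset by blast
  have inj: "inj (z ^^ i)" for i
    using z(1) by (simp add: bij_is_inj permutation_bijective permutation_funpow)
  have FD: "card (F i) = card (D \<inter> (z ^^ i) ` D)" for i
  proof -
    have "(z ^^ i) ` F i = D \<inter> (z ^^ i) ` D" unfolding F_def by auto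
    then show ?thesis using card_image[of "z ^^ i" "F i"] inj inj_on_subset subset_UNIV by metis
  qed
  have bound: "card (F i) + q \<le> 2 * k" if "i \<in> {1..<q}" for i
  proof -
    have "\<not> q dvd i" using that by (auto dest: dvd_imp_le)
    then have "\<not> 2 * card D < card A + card (D \<inter> (z ^^ i) ` D)" using no unfolding q_def by blast
    then show ?thesis using FD[of i] unfolding q_def k_def by linarith
  qed
  have "{(a, b). a \<in> D \<and> b \<in> D \<and> a \<noteq> b} \<subseteq> (\<lambda>(i, a). (a, (z ^^ i) a)) ` (SIGMA i:{1..<q}. F i)"
  proof (clarify)
    fix a b assume ab: "a \<in> D" "b \<in> D" "a \<noteq> b"
    then have abA: "a \<in> A" "b \<in> A" using D by auto
    obtain i where i: "(z ^^ i) a = b" using cyclic_on_reach[OF z(2) abA] by blast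
    have "(z ^^ q) a = a" using cyclic_on_funpow_fixes[OF z abA(1)] unfolding q_def by simp
    then have i': "(z ^^ (i mod q)) a = b" using funpow_mod_eq[of q z a i] i by simp
    moreover have "i mod q \<noteq> 0" using i' ab(3) by (intro notI) simp
    moreover have "i mod q < q" using q prime_gt_0_nat unfolding q_def by simp
    ultimately show "(a, b) \<in> (\<lambda>(i, a). (a, (z ^^ i) a)) ` (SIGMA i:{1..<q}. F i)"
      using ab by (intro image_eqI[of _ _ "(i mod q, a)"]) (auto simp: F_def)
  qed
  moreover have finF: "finite (SIGMA i:{1..<q}. F i)" unfolding F_def using finD by auto
  ultimately have "card {(a, b). a \<in> D \<and> b \<in> D \<and> a \<noteq> b} \<le> card (SIGMA i:{1..<q}. F i)"
    by (rule surj_card_le [rotated])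
  also have "\<dots> = (\<Sum>i\<in>{1..<q}. card (F i))"
    by (rule card_SigmaI) (auto simp: F_def finD)
  finally have 1: "card {(a, b). a \<in> D \<and> b \<in> D \<and> a \<noteq> b} \<le> (\<Sum>i\<in>{1..<q}. card (F i))" .
  have "{(a, b). a \<in> D \<and> b \<in> D \<and> a \<noteq> b} = D \<times> D - (\<lambda>a. (a, a)) ` D" by auto
  moreover have "card (D \<times> D - (\<lambda>a. (a, a)) ` D) = k * k - k"
    using finD by (subst card_Diff_subset) (auto simp: card_image inj_on_def card_cartesian_product k_def)
  ultimately have "k * k - k \<le> (\<Sum>i\<in>{1..<q}. card (F i))" using 1 by simp
  then have "k * k \<le> (\<Sum>i\<in>{1..<q}. card (F i)) + k" by simp
  then have "int (k * k) \<le> int ((\<Sum>i\<in>{1..<q}. card (F i)) + k)" by (simp only: of_nat_le_iff)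
  then have "int k * int k - int k \<le> (\<Sum>i\<in>{1..<q}. int (card (F i)))" by simp
  also have "\<dots> \<le> (\<Sum>i\<in>{1..<q}. 2 * int k - int q)"
    using bound by (intro sum_mono) force
  also have "\<dots> = (int q - 1) * (2 * int k - int q)"
    using q prime_gt_0_nat[of q] unfolding q_def by (simp add: of_nat_diff)
  finally have 2: "int k * int k - int k \<le> (int q - 1) * (2 * int k - int q)" .
  obtain m where m: "q = k + m" "m \<ge> 2"
    using gap that[of "q - k"] unfolding q_def k_def by simp
  have "int m * int m \<le> int m" using 2 unfolding m(1) by (simp add: algebra_simps)
  then have "int m * int m \<le> 1 * int m" by simp
  then show False using m(2) by (simp only: mult_le_cancel_right) linarith
qed

text \<open>The aim is that the translates of the support \<open>A\<close> of a cycle of prime length are all sets of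
  that size. The idea is to exchange points: \<open>\<beta>\<close> is exchangeable for \<open>B\<close> if replacing any one point of
  \<open>B\<close> by \<open>\<beta>\<close> gives a translate again. Together with \<open>B\<close> these points form the hull of \<open>B\<close>. All subsets
  of a hull of the right size turn out to be translates with the same hull
  (\<open>hull_generated\<close>), and hulls are disjoint or equal (\<open>meeting_translates_same_hull\<close>). So a hull is a
  block with more than one point, which in a primitive group is everything.\<close>
locale primitive_group_with_prime_cycle = permutation_group \<Omega> G
  for \<Omega> :: "'a set" and G :: "('a \<Rightarrow> 'a) set" +
  fixes z :: "'a \<Rightarrow> 'a" and A :: "'a set"
  assumes prim: "primitive"
    and z: "z \<in> G" "cyclic_on z A" "fixes_outside z A"
    and A_sub: "A \<subseteq> \<Omega>"
    and prime_A: "prime (card A)"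
begin

definition translates :: "'a set set" where
  "translates = {g ` A |g. g \<in> G}"

definition exchangeable :: "'a set \<Rightarrow> 'a set" where
  "exchangeable B = {\<beta> \<in> \<Omega> - B. \<forall>\<alpha>\<in>B. insert \<beta> (B - {\<alpha>}) \<in> translates}"

definition exchange_hull :: "'a set \<Rightarrow> 'a set" where
  "exchange_hull B = B \<union> exchangeable B"

lemma translateD:
  assumes "B \<in> translates"
  shows "B \<subseteq> \<Omega>" "card B = card A" "finite B"
proof -
  obtain g where g: "g \<in> G" "B = g ` A" using assms unfolding translates_def by blast
  show "B \<subseteq> \<Omega>" using image_subset[OF g(1) A_sub] g(2) by simp
  then show "finite B" using finite_subset finite_points by blast
  show "card B = card A" using card_image_mem[OF g(1)] g(2) by simp
qed

lemma A_translate: "A \<in> translates"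
proof -
  have "A = id ` A" by simp
  then show ?thesis unfolding translates_def using id_mem by blast
qed

lemma image_translate:
  assumes "g \<in> G" "B \<in> translates"
  shows "g ` B \<in> translates"
proof -
  obtain h where h: "h \<in> G" "B = h ` A" using assms(2) unfolding translates_def by blast
  have "g ` B = (g \<circ> h) ` A" using h(2) by (simp add: image_comp)
  then show ?thesis unfolding translates_def using comp_mem[OF assms(1) h(1)] by blast
qed

lemma translate_cycle:
  assumes "B \<in> translates"
  obtains y where "y \<in> G" "cyclic_on y B" "fixes_outside y B"
proof -
  obtain h where h: "h \<in> G" "B = h ` A" using assms unfolding translates_def by blast
  show thesis using cyclic_conj_mem[OF h(1) z] that unfolding h(2) by blast
qed

text \<open>One successful replacement suffices, as the cycle on \<open>B\<close> fixes \<open>\<beta>\<close> and moves the removed point to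
  any other.\<close>
lemma exchangeableI:
  assumes B: "B \<in> translates" and \<beta>: "\<beta> \<in> \<Omega>" "\<beta> \<notin> B" and \<alpha>: "\<alpha> \<in> B"
    and mem: "insert \<beta> (B - {\<alpha>}) \<in> translates"
  shows "\<beta> \<in> exchangeable B"
proof -
  obtain y where y: "y \<in> G" "cyclic_on y B" "fixes_outside y B" using translate_cycle[OF B] .
  have "insert \<beta> (B - {\<gamma>}) \<in> translates" if \<gamma>: "\<gamma> \<in> B" for \<gamma>
  proof -
    obtain i where i: "(y ^^ i) \<alpha> = \<gamma>" using cyclic_on_reach[OF y(2) \<alpha> \<gamma>] by blast
    have g: "y ^^ i \<in> G" using funpow_mem[OF y(1)] .
    have "(y ^^ i) \<beta> = \<beta>" using fixes_outside_funpow[OF y(3)] \<beta> unfolding fixes_outside_def by blast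
    moreover have "(y ^^ i) ` (B - {\<alpha>}) = B - {\<gamma>}"
      using image_set_diff[OF inj_mem[OF g], of B "{\<alpha>}"] i
        cyclic_on_funpow_image[OF permutation_mem[OF y(1)] y(2)] by simp
    ultimately have "(y ^^ i) ` insert \<beta> (B - {\<alpha>}) = insert \<beta> (B - {\<gamma>})" by simp
    then show ?thesis using image_translate[OF g mem] by simp
  qed
  then show ?thesis unfolding exchangeable_def using \<beta> by blast
qed

lemma hull_subset: "B \<in> translates \<Longrightarrow> exchange_hull B \<subseteq> \<Omega>"
  using translateD(1) unfolding exchange_hull_def exchangeable_def by blast

lemma hull_exchange_le:
  assumes B: "B \<in> translates" and \<beta>: "\<beta> \<in> exchangeable B" and \<alpha>: "\<alpha> \<in> B"
  shows "insert \<beta> (B - {\<alpha>}) \<in> translates" "\<alpha> \<in> exchangeable (insert \<beta> (B - {\<alpha>}))"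
    "exchange_hull B \<subseteq> exchange_hull (insert \<beta> (B - {\<alpha>}))"
proof -
  define C where "C = insert \<beta> (B - {\<alpha>})"
  have \<beta>': "\<beta> \<in> \<Omega>" "\<beta> \<notin> B" using \<beta> unfolding exchangeable_def by auto
  show C: "insert \<beta> (B - {\<alpha>}) \<in> translates" using \<beta> \<alpha> unfolding exchangeable_def by blast
  have \<alpha>C: "\<alpha> \<notin> C" "\<alpha> \<in> \<Omega>" "\<beta> \<in> C" unfolding C_def using \<beta>' \<alpha> translateD(1)[OF B] by auto
  have "insert \<alpha> (C - {\<beta>}) = B" unfolding C_def using \<beta>' \<alpha> by auto
  then have \<alpha>X: "\<alpha> \<in> exchangeable C"
    using exchangeableI[of C \<alpha> \<beta>] C \<alpha>C B unfolding C_def by simp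
  then show "\<alpha> \<in> exchangeable (insert \<beta> (B - {\<alpha>}))" unfolding C_def .
  have "\<gamma> \<in> exchange_hull C" if \<gamma>: "\<gamma> \<in> exchangeable B" "\<gamma> \<noteq> \<beta>" for \<gamma>
  proof -
    have \<gamma>': "\<gamma> \<in> \<Omega>" "\<gamma> \<notin> B" "insert \<gamma> (B - {\<alpha>}) \<in> translates"
      using \<gamma> \<alpha> unfolding exchangeable_def by auto
    have "insert \<gamma> (C - {\<beta>}) = insert \<gamma> (B - {\<alpha>})" unfolding C_def using \<beta>' by auto
    moreover have "\<gamma> \<notin> C" unfolding C_def using \<gamma>' \<gamma>(2) by auto
    ultimately have "\<gamma> \<in> exchangeable C"
      using exchangeableI[of C \<gamma> \<beta>] C \<alpha>C(3) \<gamma>' unfolding C_def by simp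
    then show ?thesis unfolding exchange_hull_def by blast
  qed
  moreover have "B \<subseteq> exchange_hull C" using \<alpha>X unfolding exchange_hull_def C_def by blast
  moreover have "\<beta> \<in> exchange_hull C" using \<alpha>C unfolding exchange_hull_def by blast
  ultimately show "exchange_hull B \<subseteq> exchange_hull (insert \<beta> (B - {\<alpha>}))"
    unfolding C_def exchange_hull_def[of B] by blast
qed

text \<open>An exchange can be undone by exchanging \<open>\<alpha>\<close> for \<open>\<beta>\<close>, so the inclusion of hulls holds in both
  directions.\<close>
lemma hull_exchange:
  assumes B: "B \<in> translates" and \<beta>: "\<beta> \<in> exchangeable B" and \<alpha>: "\<alpha> \<in> B"
  shows "exchange_hull (insert \<beta> (B - {\<alpha>})) = exchange_hull B"
proof
  define C where "C = insert \<beta> (B - {\<alpha>})"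
  note C = hull_exchange_le[OF assms, folded C_def]
  have "\<beta> \<notin> B" using \<beta> unfolding exchangeable_def by blast
  then have "insert \<alpha> (C - {\<beta>}) = B" "\<beta> \<in> C" unfolding C_def using \<alpha> by auto
  then show "exchange_hull (insert \<beta> (B - {\<alpha>})) \<subseteq> exchange_hull B"
    using hull_exchange_le(3)[OF C(1,2), of \<beta>] unfolding C_def by simp
qed (rule hull_exchange_le(3)[OF assms])

text \<open>Points of \<open>C\<close> are exchanged into \<open>B\<close> one at a time; the hull does not change on the way, so the
  next point remains exchangeable.\<close>
lemma hull_generated:
  assumes "B \<in> translates" "C \<subseteq> exchange_hull B" "card C = card A"
  shows "C \<in> translates \<and> exchange_hull C = exchange_hull B"
  using assms(1,2)
proof (induction "card (C - B)" arbitrary: B rule: less_induct)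
  case less
  note tB = translateD[OF less.prems(1)]
  have finC: "finite C" using finite_subset[OF less.prems(2)] finite_subset[OF hull_subset[OF less.prems(1)]] by simp
  show ?case
  proof (cases "C \<subseteq> B")
    case True
    then have "C = B" using card_subset_eq[OF tB(3)] assms(3) tB(2) by simp
    then show ?thesis using less.prems by simp
  next
    case False
    then obtain \<beta> where \<beta>: "\<beta> \<in> C" "\<beta> \<notin> B" by blast
    have "\<not> B \<subseteq> C" using card_subset_eq[OF finC, of B] assms(3) tB(2) False by auto
    then obtain \<alpha> where \<alpha>: "\<alpha> \<in> B" "\<alpha> \<notin> C" by blast
    have \<beta>X: "\<beta> \<in> exchangeable B" using \<beta> less.prems(2) unfolding exchange_hull_def by blast
    define B' where "B' = insert \<beta> (B - {\<alpha>})"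
    note B' = hull_exchange_le(1)[OF less.prems(1) \<beta>X \<alpha>(1), folded B'_def]
      hull_exchange[OF less.prems(1) \<beta>X \<alpha>(1), folded B'_def]
    have "C - B' = (C - B) - {\<beta>}" unfolding B'_def using \<alpha> by auto
    then have "card (C - B') < card (C - B)"
      using \<beta> finC by (metis DiffI card_Diff1_less finite_Diff)
    then have "C \<in> translates \<and> exchange_hull C = exchange_hull B'"
      by (rule less.hyps) (use B' less.prems(2) in simp_all)
    then show ?thesis using B'(2) by simp
  qed
qed

lemma image_hull_le:
  assumes g: "g \<in> G" and B: "B \<in> translates"
  shows "g ` exchange_hull B \<subseteq> exchange_hull (g ` B)"
proof -
  have "g \<beta> \<in> exchangeable (g ` B)" if \<beta>: "\<beta> \<in> exchangeable B" for \<beta>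
  proof -
    have "insert (g \<beta>) (g ` B - {g \<alpha>}) \<in> translates" if \<alpha>: "\<alpha> \<in> B" for \<alpha>
    proof -
      have "g ` insert \<beta> (B - {\<alpha>}) = insert (g \<beta>) (g ` B - {g \<alpha>})"
        using image_set_diff[OF inj_mem[OF g], of B "{\<alpha>}"] by simp
      then show ?thesis using image_translate[OF g] hull_exchange_le(1)[OF B \<beta> \<alpha>] by metis
    qed
    moreover have "g \<beta> \<in> \<Omega>" using \<beta> g unfolding exchangeable_def by simp
    moreover have "g \<beta> \<notin> g ` B" using \<beta> inj_image_mem_iff[OF inj_mem[OF g]] unfolding exchangeable_def by blast
    ultimately show ?thesis unfolding exchangeable_def by blast
  qed
  then show ?thesis unfolding exchange_hull_def by blast
qed

lemma image_hull:
  assumes g: "g \<in> G" and B: "B \<in> translates"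
  shows "g ` exchange_hull B = exchange_hull (g ` B)"
proof
  show "g ` exchange_hull B \<subseteq> exchange_hull (g ` B)" by (rule image_hull_le[OF assms])
  have "inv' g ` exchange_hull (g ` B) \<subseteq> exchange_hull B"
    using image_hull_le[OF inv_mem[OF g] image_translate[OF g B]] inv_image[OF g] by simp
  then have "g ` inv' g ` exchange_hull (g ` B) \<subseteq> g ` exchange_hull B" by (rule image_mono)
  then show "exchange_hull (g ` B) \<subseteq> g ` exchange_hull B" using image_inv[OF g] by simp
qed

text \<open>Among the pairs of meeting translates with different hulls take \<open>B\<close> and \<open>C\<close> with the largest
  intersection. They differ in more than one point, for otherwise \<open>C\<close> arises from \<open>B\<close> by an exchange.
  By \<open>cyclic_on_prime_overlap\<close> some nontrivial power \<open>g\<close> of the cycle on \<open>B\<close> moves \<open>C\<close> to a set with a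
  larger intersection with \<open>C\<close>, so \<open>C\<close> and \<open>g ` C\<close> have the same hull, which \<open>g\<close> preserves. But the
  power \<open>g\<close> is still a cycle on all of \<open>B\<close>, so this hull contains \<open>B\<close>.\<close>
lemma meeting_translates_same_hull:
  assumes "B \<in> translates" "C \<in> translates" "B \<inter> C \<noteq> {}"
  shows "exchange_hull B = exchange_hull C"
proof (rule ccontr)
  define bad where "bad k \<longleftrightarrow> (\<exists>B C. B \<in> translates \<and> C \<in> translates \<and> B \<inter> C \<noteq> {} \<and>
    exchange_hull B \<noteq> exchange_hull C \<and> card (B \<inter> C) = k)" for k
  assume "exchange_hull B \<noteq> exchange_hull C"
  then have ex: "bad (card (B \<inter> C))" unfolding bad_def using assms by blast
  have bnd: "k \<le> card A" if bad: "bad k" for k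
  proof -
    obtain B C where "B \<in> translates" "card (B \<inter> C) = k" using bad unfolding bad_def by blast
    then show ?thesis using translateD[of B] card_mono[of B "B \<inter> C"] by auto
  qed
  obtain k where k: "bad k" and max: "\<And>j. bad j \<Longrightarrow> j \<le> k"
    using Nat.ex_has_greatest_nat[of bad, OF ex] bnd by blast
  obtain B C where BC: "B \<in> translates" "C \<in> translates" "B \<inter> C \<noteq> {}" "exchange_hull B \<noteq> exchange_hull C"
    "card (B \<inter> C) = k" using k unfolding bad_def by blast
  note tB = translateD[OF BC(1)] and tC = translateD[OF BC(2)]
  obtain y where y: "y \<in> G" "cyclic_on y B" "fixes_outside y B" using translate_cycle[OF BC(1)] .
  \<comment> \<open>If \<open>B\<close> and \<open>C\<close> differed in one point only, an exchange would turn one into the other.\<close>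
  have gap: "card (B \<inter> C) + 2 \<le> card B"
  proof (rule ccontr)
    assume "\<not> ?thesis"
    then have large: "card B \<le> card (B \<inter> C) + 1" by simp
    have "\<not> B \<subseteq> C" using card_subset_eq[OF tC(3), of B] tB(2) tC(2) BC(4) by auto
    then obtain \<alpha> where \<alpha>: "\<alpha> \<in> B" "\<alpha> \<notin> C" by blast
    have "\<not> C \<subseteq> B" using card_subset_eq[OF tB(3), of C] tB(2) tC(2) BC(4) by auto
    then obtain \<beta> where \<beta>: "\<beta> \<in> C" "\<beta> \<notin> B" by blast
    have "B \<inter> C \<subseteq> B - {\<alpha>}" using \<alpha> by blast
    moreover have "card (B - {\<alpha>}) \<le> card (B \<inter> C)" using large \<alpha> tB(3) by simp
    ultimately have "B \<inter> C = B - {\<alpha>}" using card_seteq[of "B - {\<alpha>}" "B \<inter> C"] tB(3) by simp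
    then have sub: "insert \<beta> (B - {\<alpha>}) \<subseteq> C" using \<beta> by blast
    have "card (insert \<beta> (B - {\<alpha>})) = card C"
      using \<alpha> \<beta> tB tC card_Suc_Diff1[OF tB(3) \<alpha>(1)] by simp
    then have eq: "insert \<beta> (B - {\<alpha>}) = C" using card_subset_eq[OF tC(3) sub] by simp
    have "\<beta> \<in> exchangeable B"
      using exchangeableI[OF BC(1) _ \<beta>(2) \<alpha>(1)] eq BC(2) \<beta>(1) tC(1) by blast
    then have "exchange_hull (insert \<beta> (B - {\<alpha>})) = exchange_hull B" by (rule hull_exchange[OF BC(1) _ \<alpha>(1)])
    then show False using eq BC(4) by simp
  qed
  have pB: "prime (card B)" using prime_A tB(2) by simp
  obtain i where i: "\<not> card B dvd i"
      "2 * card (B \<inter> C) < card B + card ((B \<inter> C) \<inter> (y ^^ i) ` (B \<inter> C))"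
    using cyclic_on_prime_overlap[OF permutation_mem[OF y(1)] y(2) pB _ gap] by blast
  define g where "g = y ^^ i"
  have g: "g \<in> G" unfolding g_def by (rule funpow_mem[OF y(1)])
  have gB: "g ` B = B" unfolding g_def by (rule cyclic_on_funpow_image[OF permutation_mem[OF y(1)] y(2)])
  have gC: "g ` C \<in> translates" by (rule image_translate[OF g BC(2)])
  have "C - B \<subseteq> g ` C"
  proof
    fix u assume u: "u \<in> C - B"
    then have "g u = u"
      using fixes_outside_funpow[OF y(3), of i] tC(1) unfolding fixes_outside_def g_def by blast
    then show "u \<in> g ` C" using u by (metis DiffD1 image_eqI)
  qed
  \<comment> \<open>The intersection with the translate contains the part of \<open>C\<close> outside \<open>B\<close>, which \<open>g\<close> fixes, and
      the overlap inside \<open>B\<close>.\<close>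
  then have "(C - B) \<union> ((B \<inter> C) \<inter> g ` (B \<inter> C)) \<subseteq> C \<inter> g ` C" by blast
  then have "card ((C - B) \<union> ((B \<inter> C) \<inter> g ` (B \<inter> C))) \<le> card (C \<inter> g ` C)"
    using tC(3) by (intro card_mono) auto
  moreover have "card ((C - B) \<union> ((B \<inter> C) \<inter> g ` (B \<inter> C))) = card (C - B) + card ((B \<inter> C) \<inter> g ` (B \<inter> C))"
    using tC(3) by (intro card_Un_disjoint) auto
  moreover have "card (C - B) + card (B \<inter> C) = card B"
    using card_Diff_subset_Int[of C B] tB tC card_mono[of C "B \<inter> C"] by (simp add: Int_commute)
  ultimately have more: "k < card (C \<inter> g ` C)" using i(2) BC(5) unfolding g_def by linarith
  have hC: "exchange_hull C = exchange_hull (g ` C)"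
  proof (rule ccontr)
    assume "exchange_hull C \<noteq> exchange_hull (g ` C)"
    then have "bad (card (C \<inter> g ` C))"
      unfolding bad_def using BC(2) gC more by (metis card.empty not_less0)
    then show False using max more by (metis not_less)
  qed
  then have ginv: "g ` exchange_hull C = exchange_hull C" using image_hull[OF g BC(2)] by simp
  have "cyclic_on g B" unfolding g_def
    by (rule cyclic_on_funpow[OF permutation_mem[OF y(1)] y(2)])
      (use i(1) prime_imp_coprime[OF pB] coprime_commute in blast)
  then have "B \<inter> exchange_hull C = {} \<or> B \<subseteq> exchange_hull C"
    using cyclic_on_invariant_cases[of g B "exchange_hull C"] ginv by simp
  moreover have "B \<inter> exchange_hull C \<noteq> {}" using BC(3) unfolding exchange_hull_def by blast
  ultimately have "B \<subseteq> exchange_hull C" by blast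
  then show False using hull_generated[OF BC(2) _ tB(2)] BC(4) by simp
qed

lemma block_hull: "block (exchange_hull A)"
  unfolding block_def
proof (intro conjI ballI)
  show "exchange_hull A \<subseteq> \<Omega>" by (rule hull_subset[OF A_translate])
  have "A \<noteq> {}" using z(2) unfolding cyclic_on_def by blast
  then show "exchange_hull A \<noteq> {}" unfolding exchange_hull_def by blast
  fix g assume g: "g \<in> G"
  show "g ` exchange_hull A = exchange_hull A \<or> g ` exchange_hull A \<inter> exchange_hull A = {}"
  proof (rule disjCI)
    assume "g ` exchange_hull A \<inter> exchange_hull A \<noteq> {}"
    then obtain u where u: "u \<in> exchange_hull (g ` A)" "u \<in> exchange_hull A" using image_hull[OF g A_translate] by blast
    have ex: "\<exists>C. C \<in> translates \<and> u \<in> C \<and> exchange_hull C = exchange_hull B" if B: "B \<in> translates" "u \<in> exchange_hull B" for B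
    proof (cases "u \<in> B")
      case False
      then have uX: "u \<in> exchangeable B" using B(2) unfolding exchange_hull_def by blast
      obtain \<alpha> where \<alpha>: "\<alpha> \<in> B" using B(1) translateD(2)[OF B(1)] prime_A by fastforce
      show ?thesis using hull_exchange_le(1)[OF B(1) uX \<alpha>] hull_exchange[OF B(1) uX \<alpha>] by blast
    qed (use B in blast)
    obtain C where C: "C \<in> translates" "u \<in> C" "exchange_hull C = exchange_hull (g ` A)"
      using ex[OF image_translate[OF g A_translate] u(1)] by blast
    obtain D where D: "D \<in> translates" "u \<in> D" "exchange_hull D = exchange_hull A"
      using ex[OF A_translate u(2)] by blast
    have "exchange_hull C = exchange_hull D" using meeting_translates_same_hull[OF C(1) D(1)] C(2) D(2) by blast
    then show "g ` exchange_hull A = exchange_hull A" using C(3) D(3) image_hull[OF g A_translate] by simp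
  qed
qed

theorem all_subsets_are_translates:
  assumes "B \<subseteq> \<Omega>" "card B = card A"
  shows "B \<in> translates"
proof -
  have "exchange_hull A = \<Omega>"
  proof -
    have "card A \<le> card (exchange_hull A)"
      using hull_subset[OF A_translate] finite_subset[OF _ finite_points]
      by (intro card_mono) (auto simp: exchange_hull_def)
    then have "card (exchange_hull A) \<noteq> 1" using prime_ge_2_nat[OF prime_A] by linarith
    then show ?thesis using prim block_hull unfolding primitive_def by blast
  qed
  then show ?thesis using hull_generated[OF A_translate] assms by simp
qed

text \<open>Given \<open>u\<close>, \<open>v\<close>, \<open>w\<close>, there is room for two sets of size \<open>card A\<close> that contain \<open>u\<close>, \<open>v\<close> and
  \<open>u\<close>, \<open>w\<close> respectively and meet only in \<open>u\<close>. Both are supports of conjugate cycles, and suitable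
  powers of these send \<open>u\<close> to \<open>v\<close> and to \<open>w\<close>.\<close>
theorem all_three_cycles_of_prime_cycle:
  assumes room: "2 * card A \<le> card \<Omega> + 1"
  shows "all_three_cycles"
  unfolding all_three_cycles_def
proof (intro ballI impI)
  fix u v w assume uvw: "u \<in> \<Omega>" "v \<in> \<Omega>" "w \<in> \<Omega>" "distinct [u, v, w]"
  have q2: "card A \<ge> 2" using prime_ge_2_nat[OF prime_A] .
  have dist: "u \<noteq> v" "u \<noteq> w" "v \<noteq> w" using uvw(4) by auto
  have c3: "card (\<Omega> - {u, v, w}) = card \<Omega> - 3" using uvw by (subst card_Diff_subset) auto
  have "card A - 2 \<le> card (\<Omega> - {u, v, w})" using room q2 c3 by linarith
  then obtain P where P: "P \<subseteq> \<Omega> - {u, v, w}" "card P = card A - 2" "finite P"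
    by (rule obtain_subset_with_card_n)
  have "card (\<Omega> - {u, v, w} - P) = card \<Omega> - 3 - (card A - 2)"
    using P c3 by (simp add: card_Diff_subset)
  then have "card A - 2 \<le> card (\<Omega> - {u, v, w} - P)" using room q2 by linarith
  then obtain Q where Q: "Q \<subseteq> \<Omega> - {u, v, w} - P" "card Q = card A - 2" "finite Q"
    by (rule obtain_subset_with_card_n)
  define B where "B = insert u (insert v P)"
  define C where "C = insert u (insert w Q)"
  have "card B = card A" unfolding B_def using P dist q2 by (subst card_insert_disjoint; auto)+
  moreover have "card C = card A" unfolding C_def using Q dist q2 by (subst card_insert_disjoint; auto)+
  moreover have "B \<subseteq> \<Omega>" "C \<subseteq> \<Omega>" unfolding B_def C_def using P Q uvw by auto
  ultimately have tr: "B \<in> translates" "C \<in> translates" using all_subsets_are_translates by blast+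
  have BC: "B \<inter> C = {u}" unfolding B_def C_def using P Q dist by auto
  obtain y where y: "y \<in> G" "cyclic_on y B" "fixes_outside y B" using translate_cycle[OF tr(1)] .
  obtain y' where y': "y' \<in> G" "cyclic_on y' C" "fixes_outside y' C" using translate_cycle[OF tr(2)] .
  obtain i where i: "(y ^^ i) u = v" using cyclic_on_reach[OF y(2), of u v] unfolding B_def by auto
  obtain j where j: "(y' ^^ j) u = w" using cyclic_on_reach[OF y'(2), of u w] unfolding C_def by auto
  have "cycle_of_list [u, (y ^^ i) u, (y' ^^ j) u] \<in> G"
    using i j dist by (intro three_cycle_of_supports_meeting_in_point(1)[OF funpow_mem[OF y(1)]
        fixes_outside_funpow[OF y(3)] funpow_mem[OF y'(1)] fixes_outside_funpow[OF y'(3)] BC]) auto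
  then show "cycle_of_list [u, v, w] \<in> G" using i j by simp
qed

end

section \<open>Cycle types that force all three-cycles\<close>

text \<open>A fixed point is a cycle of length 1, so for prime \<open>p\<close> this excludes fixed points.\<close>
definition all_cycles_of_length :: "nat \<Rightarrow> 'a set \<Rightarrow> ('a \<Rightarrow> 'a) \<Rightarrow> bool" where
  "all_cycles_of_length p \<Omega> x \<longleftrightarrow> (\<forall>C\<subseteq>\<Omega>. cyclic_on x C \<longrightarrow> card C = p)"

context permutation_group
begin

text \<open>An invariant set is a disjoint union of cycles.\<close>
lemma dvd_card_invariant:
  assumes x: "x \<in> G" "all_cycles_of_length p \<Omega> x" and S: "S \<subseteq> \<Omega>" "x ` S = S"
  shows "p dvd card S"
proof -
  have perm: "permutation x" using permutation_mem[OF x(1)] .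
  define P where "P = Orbits.orbit x ` S"
  have orb: "Orbits.orbit x u \<subseteq> S" "cyclic_on x (Orbits.orbit x u)" "u \<in> Orbits.orbit x u" if u: "u \<in> S" for u
  proof -
    show c: "cyclic_on x (Orbits.orbit x u)" by (rule cyclic_on_orbit'[OF perm])
    show m: "u \<in> Orbits.orbit x u" by (rule permutation_self_in_orbit[OF perm])
    show "Orbits.orbit x u \<subseteq> S"
      using cyclic_on_invariant_cases[OF c, of S] S(2) u m by auto
  qed
  have fS: "finite S" using S(1) finite_subset finite_points by blast
  have U: "\<Union>P = S" unfolding P_def using orb by blast
  have "p * card P = card (\<Union>P)"
  proof (rule card_partition)
    show "finite P" unfolding P_def using fS by simp
    show "finite (\<Union>P)" using U fS by simp
    show "card c = p" if c: "c \<in> P" for c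
    proof -
      obtain u where u: "u \<in> S" "c = Orbits.orbit x u" using c unfolding P_def by blast
      then show ?thesis using x(2) orb[OF u(1)] S(1) unfolding all_cycles_of_length_def by auto
    qed
    show "c1 \<inter> c2 = {}" if c: "c1 \<in> P" "c2 \<in> P" "c1 \<noteq> c2" for c1 c2
    proof (rule ccontr)
      assume "c1 \<inter> c2 \<noteq> {}"
      then obtain w where w: "w \<in> c1" "w \<in> c2" by blast
      obtain u v where "u \<in> S" "c1 = Orbits.orbit x u" "v \<in> S" "c2 = Orbits.orbit x v"
        using c unfolding P_def by blast
      then have "Orbits.orbit x w = c1" "Orbits.orbit x w = c2" using orbit_cyclic_eq3 orb(2) w by metis+
      then show False using c(3) by simp
    qed
  qed
  then show ?thesis using U by (metis dvd_triv_left)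
qed

text \<open>It suffices to apply the hypothesis to an orbit, which is invariant under the group.\<close>
lemma transitiveI:
  assumes "\<Omega> \<noteq> {}" "\<And>S. S \<subseteq> \<Omega> \<Longrightarrow> S \<noteq> {} \<Longrightarrow> (\<And>g. g \<in> G \<Longrightarrow> g ` S = S) \<Longrightarrow> S = \<Omega>"
  shows "transitive"
  unfolding transitive_def
proof (intro ballI)
  fix u v assume uv: "u \<in> \<Omega>" "v \<in> \<Omega>"
  define S where "S = {g u |g. g \<in> G}"
  have sub: "g ` S \<subseteq> S" if g: "g \<in> G" for g
  proof
    fix w assume "w \<in> g ` S"
    then obtain h where h: "h \<in> G" "w = (g \<circ> h) u" unfolding S_def by auto
    then show "w \<in> S" unfolding S_def using comp_mem[OF g h(1)] by blast
  qed
  have "S = \<Omega>"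
  proof (rule assms(2))
    show "S \<subseteq> \<Omega>" unfolding S_def using uv by auto
    show "S \<noteq> {}" unfolding S_def using id_mem by blast
    fix g assume g: "g \<in> G"
    have "g ` inv' g ` S \<subseteq> g ` S" by (rule image_mono[OF sub[OF inv_mem[OF g]]])
    then show "g ` S = S" using image_inv[OF g] sub[OF g] by auto
  qed
  then show "\<exists>g\<in>G. g u = v" using uv(2) unfolding S_def by blast
qed

lemma invariant_card_cases:
  assumes "y ` S = S" "cyclic_on y C"
  shows "card (S \<inter> C) = 0 \<or> card (S \<inter> C) = card C"
proof -
  have "C \<inter> S = {} \<or> C \<inter> S = C"
    using cyclic_on_invariant_cases[OF assms(2), of S] assms(1) by auto
  then show ?thesis by (auto simp: Int_commute)
qed

text \<open>The way to extract a single cycle of \<open>y\<close>: raise it to a multiple of the other cycle lengths.\<close>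
lemma power_isolates_cycle:
  assumes y: "y \<in> G" "cyclic_on y C" and cop: "coprime k (card C)"
    and rest: "\<And>u. u \<in> \<Omega> - C \<Longrightarrow> \<exists>C'. cyclic_on y C' \<and> u \<in> C' \<and> card C' dvd k"
  shows "y ^^ k \<in> G" "cyclic_on (y ^^ k) C" "fixes_outside (y ^^ k) C"
proof -
  show "y ^^ k \<in> G" by (rule funpow_mem[OF y(1)])
  show "cyclic_on (y ^^ k) C" by (rule cyclic_on_funpow[OF permutation_mem[OF y(1)] y(2) cop])
  show "fixes_outside (y ^^ k) C" unfolding fixes_outside_def
    using rest cyclic_on_funpow_fixes[OF permutation_mem[OF y(1)]] by blast
qed

lemma all_three_cycles_prime_degree:
  assumes x: "x \<in> G" "all_cycles_of_length (card \<Omega>) \<Omega> x" and n: "prime (card \<Omega>)" "card \<Omega> \<ge> 5"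
    and y: "y \<in> G" "cyclic_on y A" "y permutes A" "A \<subseteq> \<Omega>" "card A = 3"
  shows "all_three_cycles"
proof -
  have fix_y: "fixes_outside y A" using permutes_not_in[OF y(3)] unfolding fixes_outside_def by blast
  have "transitive"
  proof (rule transitiveI)
    show "\<Omega> \<noteq> {}" using n(2) by auto
    fix S assume S: "S \<subseteq> \<Omega>" "S \<noteq> {}" "\<And>g. g \<in> G \<Longrightarrow> g ` S = S"
    have "card \<Omega> dvd card S" using dvd_card_invariant[OF x S(1)] S(3)[OF x(1)] by simp
    moreover have "card S > 0" using S(1,2) finite_subset[OF S(1) finite_points] card_gt_0_iff by blast
    ultimately have "card \<Omega> \<le> card S" by (rule dvd_imp_le)
    then show "S = \<Omega>" using card_seteq[OF finite_points S(1)] by simp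
  qed
  then have "primitive" using primitive_of_prime_degree n(1) by blast
  then interpret primitive_group_with_prime_cycle \<Omega> G y A
    by unfold_locales (use y fix_y in auto)
  show ?thesis by (rule all_three_cycles_of_prime_cycle) (use n y in simp)
qed

text \<open>As \<open>p\<close> divides the degree but neither of the two cycle lengths, the group is transitive. The
  power of \<open>y\<close> with exponent \<open>card A\<close> is the long cycle that makes the group primitive, and the power
  with exponent \<open>card \<Gamma>\<close> is the cycle of prime length.\<close>
lemma all_three_cycles_two_cycles:
  assumes x: "x \<in> G" "all_cycles_of_length p \<Omega> x" and p: "prime p" "p dvd card \<Omega>"
    and y: "y \<in> G" "cyclic_on y A" "cyclic_on y \<Gamma>" and part: "A \<union> \<Gamma> = \<Omega>" "A \<inter> \<Gamma> = {}"
    and q: "prime (card A)" "\<not> card A dvd card \<Omega>" "2 * card A < card \<Omega>"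
  shows "all_three_cycles"
proof -
  have fin: "finite A" "finite \<Gamma>" using y finite_cyclic_on by blast+
  have sum: "card \<Omega> = card A + card \<Gamma>" using part card_Un_disjoint[OF fin] by simp
  have pA: "\<not> p dvd card A"
    using p q(1,2) primes_dvd_imp_eq by blast
  then have p\<Gamma>: "\<not> p dvd card \<Gamma>" using p(2) sum by (metis dvd_add_left_iff)
  have tr: "transitive"
  proof (rule transitiveI)
    show "\<Omega> \<noteq> {}" using q(3) by auto
    fix S assume S: "S \<subseteq> \<Omega>" "S \<noteq> {}" "\<And>g. g \<in> G \<Longrightarrow> g ` S = S"
    have d: "p dvd card S" using dvd_card_invariant[OF x S(1)] S(3)[OF x(1)] by simp
    have "S = (S \<inter> A) \<union> (S \<inter> \<Gamma>)" using S(1) part by blast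
    then have cS: "card S = card (S \<inter> A) + card (S \<inter> \<Gamma>)"
      using card_Un_disjoint[of "S \<inter> A" "S \<inter> \<Gamma>"] fin part(2) by auto
    have "card S > 0" using S(1,2) finite_subset[OF S(1) finite_points] card_gt_0_iff by blast
    then have "card S = card \<Omega>"
      using invariant_card_cases[OF S(3)[OF y(1)] y(2)] invariant_card_cases[OF S(3)[OF y(1)] y(3)]
        d cS pA p\<Gamma> sum by auto
    then show "S = \<Omega>" using card_seteq[OF finite_points S(1)] by simp
  qed
  have "\<not> card A dvd card \<Gamma>" using q(2) sum by simp
  then have cop: "coprime (card A) (card \<Gamma>)" using prime_imp_coprime[OF q(1)] by blast
  have z: "y ^^ card \<Gamma> \<in> G" "cyclic_on (y ^^ card \<Gamma>) A" "fixes_outside (y ^^ card \<Gamma>) A"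
    by (rule power_isolates_cycle[OF y(1,2)]; use cop y(3) part in \<open>auto simp: coprime_commute\<close>)+
  have c: "y ^^ card A \<in> G" "cyclic_on (y ^^ card A) \<Gamma>" "fixes_outside (y ^^ card A) \<Gamma>"
    by (rule power_isolates_cycle[OF y(1,3)]; use cop y(2) part in \<open>auto simp: coprime_commute\<close>)+
  have "\<Omega> - \<Gamma> = A" "\<Gamma> \<subseteq> \<Omega>" using part by auto
  moreover have "coprime (card A) (card \<Omega>)" using prime_imp_coprime[OF q(1,2)] .
  ultimately have "primitive" using primitive_of_long_cycle[OF tr c] q(3) sum by simp
  then interpret primitive_group_with_prime_cycle \<Omega> G "y ^^ card \<Gamma>" A
    by unfold_locales (use z part q(1) in auto)
  show ?thesis by (rule all_three_cycles_of_prime_cycle) (use q(3) in simp)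
qed

text \<open>Write \<open>n\<close> for the odd degree. Its divisor \<open>p\<close> is odd, so it divides none of 2, 4, \<open>n - 4\<close> and \<open>n - 2\<close>, and the group is
  transitive. The square of \<open>y\<close> is a cycle with four fixed points, a number coprime to \<open>n\<close>;
  the power with exponent \<open>card \<Gamma>\<close> is a double transposition, and averaging applies to it
  because \<open>3\<^sup>2 < n - 1\<close>. In degree 9 this inequality fails, but there \<open>y\<^sup>2\<close> is a 5-cycle and \<open>2 \<cdot> 5 \<le> 9 + 1\<close>.\<close>
lemma all_three_cycles_double_transposition:
  assumes x: "x \<in> G" "all_cycles_of_length p \<Omega> x" and p: "prime p" "p dvd card \<Omega>"
    and y: "y \<in> G" "cyclic_on y P" "cyclic_on y Q" "cyclic_on y \<Gamma>"
    and part: "P \<union> Q \<union> \<Gamma> = \<Omega>" "P \<inter> Q = {}" "P \<inter> \<Gamma> = {}" "Q \<inter> \<Gamma> = {}"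
    and card: "card P = 2" "card Q = 2" "odd (card \<Omega>)" "card \<Omega> \<ge> 9"
  shows "all_three_cycles"
proof -
  have fin: "finite P" "finite Q" "finite \<Gamma>" using y finite_cyclic_on by blast+
  have \<Gamma>4: "\<Omega> - \<Gamma> = P \<union> Q" "\<Gamma> \<subseteq> \<Omega>" using part by auto
  have PQ: "card (P \<union> Q) = 4" using card_Un_disjoint[OF fin(1,2) part(2)] card by simp
  have sum: "card \<Omega> = 4 + card \<Gamma>"
    using card_Un_disjoint[of "P \<union> Q" \<Gamma>] fin part PQ by auto
  have odd\<Gamma>: "odd (card \<Gamma>)" using sum card(3) by simp
  have p2: "\<not> p dvd 2"
  proof
    assume "p dvd 2"
    then have "p = 2" using p(1) primes_dvd_imp_eq two_is_prime_nat by blast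
    then show False using p(2) card(3) by simp
  qed
  then have p4: "\<not> p dvd 4" using prime_dvd_mult_nat[OF p(1), of 2 2] by simp
  have p\<Gamma>: "\<not> p dvd card \<Gamma>" using p(2) p4 sum by (metis dvd_add_left_iff)
  have p\<Gamma>2: "\<not> p dvd card \<Gamma> + 2"
  proof
    assume "p dvd card \<Gamma> + 2"
    then have "p dvd (card \<Gamma> + 2) + 2 \<longleftrightarrow> p dvd 2" by (rule dvd_add_right_iff)
    moreover have "(card \<Gamma> + 2) + 2 = card \<Omega>" using sum by simp
    ultimately show False using p(2) p2 by simp
  qed
  have tr: "transitive"
  proof (rule transitiveI)
    show "\<Omega> \<noteq> {}" using card(4) by auto
    fix S assume S: "S \<subseteq> \<Omega>" "S \<noteq> {}" "\<And>g. g \<in> G \<Longrightarrow> g ` S = S"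
    have d: "p dvd card S" using dvd_card_invariant[OF x S(1)] S(3)[OF x(1)] by simp
    have "S = ((S \<inter> P) \<union> (S \<inter> Q)) \<union> (S \<inter> \<Gamma>)" using S(1) part by blast
    moreover have "card ((S \<inter> P) \<union> (S \<inter> Q)) = card (S \<inter> P) + card (S \<inter> Q)"
      using fin part by (intro card_Un_disjoint) auto
    moreover have "card (((S \<inter> P) \<union> (S \<inter> Q)) \<union> (S \<inter> \<Gamma>)) = card ((S \<inter> P) \<union> (S \<inter> Q)) + card (S \<inter> \<Gamma>)"
      using fin part by (intro card_Un_disjoint) auto
    ultimately have cS: "card S = card (S \<inter> P) + card (S \<inter> Q) + card (S \<inter> \<Gamma>)" by simp
    have "card S \<in> {0, 2, 4, card \<Gamma>, card \<Gamma> + 2, card \<Gamma> + 4}"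
      using invariant_card_cases[OF S(3)[OF y(1)] y(2)] invariant_card_cases[OF S(3)[OF y(1)] y(3)]
        invariant_card_cases[OF S(3)[OF y(1)] y(4)] cS card(1,2) by auto
    moreover have "card S \<notin> {2, 4, card \<Gamma>, card \<Gamma> + 2}" using d p2 p4 p\<Gamma> p\<Gamma>2 by auto
    moreover have "card S \<noteq> 0" using S(1,2) finite_subset[OF S(1) finite_points] by simp
    ultimately have "card S = card \<Omega>" using sum by simp
    then show "S = \<Omega>" using card_seteq[OF finite_points S(1)] by simp
  qed
  have c: "y ^^ 2 \<in> G" "cyclic_on (y ^^ 2) \<Gamma>" "fixes_outside (y ^^ 2) \<Gamma>"
  proof -
    have "coprime 2 (card \<Gamma>)" using odd\<Gamma> by simp
    moreover have "\<exists>C'. cyclic_on y C' \<and> u \<in> C' \<and> card C' dvd 2" if "u \<in> \<Omega> - \<Gamma>" for u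
      using that y card \<Gamma>4 by (metis UnE dvd_refl)
    ultimately show "y ^^ 2 \<in> G" "cyclic_on (y ^^ 2) \<Gamma>" "fixes_outside (y ^^ 2) \<Gamma>"
      using power_isolates_cycle[OF y(1,4)] by blast+
  qed
  have "coprime 4 (card \<Omega>)" using card(3) coprime_power_left_iff[of 2 2 "card \<Omega>"] by simp
  then have pr: "primitive"
    using primitive_of_long_cycle[OF tr c \<Gamma>4(2)] \<Gamma>4(1) PQ sum card(4) by simp
  show ?thesis
  proof (cases "card \<Omega> = 9")
    case True
    then have c5: "card \<Gamma> = 5" using sum by simp
    interpret primitive_group_with_prime_cycle \<Omega> G "y ^^ 2" \<Gamma>
      by unfold_locales (use c pr c5 \<Gamma>4 in auto)
    show ?thesis by (rule all_three_cycles_of_prime_cycle) (use True c5 in simp)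
  next
    case False
    have n: "card \<Omega> \<ge> 11" using False card(3,4) by presburger
    have ss: "\<Gamma> \<subset> \<Omega>" using \<Gamma>4 PQ by auto
    have dt: "doubly_transitive" 
      by (rule doubly_transitive_of_long_cycle[OF pr c ss]) (use sum n in simp)
    define v where "v = y ^^ card \<Gamma>"
    have v: "v \<in> G" "fixes_outside v (P \<union> Q)"
    proof -
      show "v \<in> G" unfolding v_def by (rule funpow_mem[OF y(1)])
      show "fixes_outside v (P \<union> Q)" unfolding fixes_outside_def v_def
        using cyclic_on_funpow_fixes[OF permutation_mem[OF y(1)] y(4)] part by auto
    qed
    obtain \<delta> where \<delta>: "\<delta> \<in> P" using card(1) by fastforce
    have "v \<delta> \<noteq> \<delta>" unfolding v_def
      using cyclic_on_funpow_fixes_iff[OF permutation_mem[OF y(1)] y(2) \<delta>] card(1) odd\<Gamma> by simp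
    moreover have "(card (P \<union> Q) - 1)\<^sup>2 < card \<Omega> - 1" using PQ n by simp
    ultimately show ?thesis
      using all_three_cycles_of_small_support[OF dt v, of \<delta>] \<delta> part(1) by blast
  qed
qed

lemma three_cycle_memI:
  assumes "h \<in> G" "distinct [a, b, c]" "h a = b" "h b = c" "h c = a"
    and "\<And>u. u \<in> \<Omega> - {a, b, c} \<Longrightarrow> h u = u" "{a, b, c} \<subseteq> \<Omega>"
  shows "cycle_of_list [a, b, c] \<in> G"
proof -
  have "h u = cycle_of_list [a, b, c] u" for u
    unfolding cycle_of_list_3[OF assms(2)] using assms permutes_not_in[OF perm[OF assms(1)], of u] by auto
  then have "h = cycle_of_list [a, b, c]" by blast
  then show ?thesis using assms(1) by metis
qed

text \<open>The 5-cycle makes the group doubly transitive. Let \<open>\<delta>\<close> be its fixed point and conjugate \<open>y\<close> to some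
  \<open>w\<close> that has \<open>\<delta>\<close> in its 2-cycle. Numbering the other points along the 5-cycle, starting with the
  partner of \<open>\<delta>\<close>, leaves six possibilities for the 4-cycle of \<open>w\<close>. In each of them the exhibited word
  in \<open>x\<close> and \<open>w\<close> is a 3-cycle; the words were found by a search through short products.\<close>
lemma all_three_cycles_degree_six:
  assumes n: "card \<Omega> = 6"
    and x: "x \<in> G" "cyclic_on x \<Gamma>" "x permutes \<Gamma>" "\<Gamma> \<subseteq> \<Omega>" "card \<Gamma> = 5"
    and y: "y \<in> G" "cyclic_on y P" "cyclic_on y Q" "P \<union> Q = \<Omega>" "P \<inter> Q = {}" "card P = 2" "card Q = 4"
  shows "all_three_cycles"
proof -
  have fix_x: "fixes_outside x \<Gamma>" using permutes_not_in[OF x(3)] unfolding fixes_outside_def by blast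
  have fin: "finite P" "finite Q" "finite \<Gamma>" using y x finite_cyclic_on by blast+
  have "card (\<Omega> - \<Gamma>) = 1" using x(4,5) n fin(3) by (simp add: card_Diff_subset)
  then obtain \<delta> where \<delta>: "\<Omega> - \<Gamma> = {\<delta>}" using card_1_singletonE by blast
  have \<Omega>: "\<Omega> = insert \<delta> \<Gamma>" "\<delta> \<notin> \<Gamma>" using \<delta> x(4) by auto
  have x\<delta>: "x \<delta> = \<delta>" using fix_x \<delta> unfolding fixes_outside_def by blast
  have tr: "transitive"
  proof (rule transitiveI)
    show "\<Omega> \<noteq> {}" using n by auto
    fix S assume S: "S \<subseteq> \<Omega>" "S \<noteq> {}" "\<And>g. g \<in> G \<Longrightarrow> g ` S = S"
    have "card S = card (S \<inter> P) + card (S \<inter> Q)"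
    proof -
      have "S = (S \<inter> P) \<union> (S \<inter> Q)" using S(1) y(4) by blast
      then show ?thesis using card_Un_disjoint[of "S \<inter> P" "S \<inter> Q"] fin y(5) by auto
    qed
    then have 1: "card S \<in> {0, 2, 4, 6}"
      using invariant_card_cases[OF S(3)[OF y(1)] y(2)] invariant_card_cases[OF S(3)[OF y(1)] y(3)] y(6,7) by auto
    have "card S = card (S \<inter> \<Gamma>) + card (S \<inter> {\<delta>})"
    proof -
      have "S = (S \<inter> \<Gamma>) \<union> (S \<inter> {\<delta>})" using S(1) \<Omega> by blast
      then show ?thesis using card_Un_disjoint[of "S \<inter> \<Gamma>" "S \<inter> {\<delta>}"] fin \<Omega>(2) by auto
    qed
    moreover have "card (S \<inter> {\<delta>}) \<le> 1" using card_mono[of "{\<delta>}" "S \<inter> {\<delta>}"] by simp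
    ultimately have "card S \<in> {0, 1, 5, 6}"
      using invariant_card_cases[OF S(3)[OF x(1)] x(2)] x(5) by auto
    moreover have "card S > 0" using S(1,2) finite_subset[OF S(1) finite_points] card_gt_0_iff by blast
    ultimately have "card S = 6" using 1 by auto
    then show "S = \<Omega>" using card_seteq[OF finite_points S(1)] n by simp
  qed
  have pr: "primitive"
    by (rule primitive_of_long_cycle[OF tr x(1,2) fix_x x(4)]) (use n x(5) \<delta> in simp_all)
  have dt: "doubly_transitive"
    by (rule doubly_transitive_of_long_cycle[OF pr x(1,2) fix_x]) (use n x(5) \<Omega> in auto)
  have "P \<noteq> {}" using y(6) by auto
  then obtain d where d: "d \<in> P" by blast
  obtain g where g: "g \<in> G" "g d = \<delta>" using transitiveD[OF tr, of d \<delta>] d y(4) \<Omega> by blast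
  define w where "w = g \<circ> y \<circ> inv' g"
  have w: "w \<in> G" "cyclic_on w (g ` P)" "cyclic_on w (g ` Q)"
    unfolding w_def by (rule conj_mem[OF g(1) y(1)] cyclic_on_conj[OF y(2) bij_mem[OF g(1)]] cyclic_on_conj[OF y(3) bij_mem[OF g(1)]])+
  have cP: "card (g ` P) = 2" "card (g ` Q) = 4" using card_image_mem[OF g(1)] y(6,7) by simp_all
  have part: "g ` P \<union> g ` Q = \<Omega>" "g ` P \<inter> g ` Q = {}"
    using image_all[OF g(1)] y(4,5) image_Int_mem[OF g(1), of P Q] by (simp_all add: image_Un [symmetric])
  have \<delta>P: "\<delta> \<in> g ` P" using d g(2) by blast
  note wp = permutation_mem[OF w(1)]
  define p0 where "p0 = w \<delta>"
  have P: "g ` P = {\<delta>, p0}" "\<delta> \<noteq> p0"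
    using cyclic_on_list[OF wp w(2) \<delta>P] cP(1) unfolding p0_def by (auto simp: numeral_2_eq_2)
  have wp0: "w p0 = \<delta>"
    using cyclic_on_funpow_fixes[OF wp w(2) \<delta>P, of 2] cP(1) unfolding p0_def by (simp add: numeral_2_eq_2)
  have "p0 \<in> \<Omega>" using part(1) P(1) by blast
  then have p0: "p0 \<in> \<Gamma>" using P(2) \<Omega> by blast
  note xp = permutation_mem[OF x(1)]
  define p1 where "p1 = x p0"
  define p2 where "p2 = x p1"
  define p3 where "p3 = x p2"
  define p4 where "p4 = x p3"
  note pdefs = p1_def p2_def p3_def p4_def
  have \<Gamma>: "\<Gamma> = {p0, p1, p2, p3, p4}" "distinct [p0, p1, p2, p3, p4]"
    using cyclic_on_list[OF xp x(2) p0] x(5) unfolding pdefs by (simp_all add: eval_nat_numeral)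
  have xs: "x p0 = p1" "x p1 = p2" "x p2 = p3" "x p3 = p4" unfolding pdefs by simp_all
  have xp4: "x p4 = p0"
    using cyclic_on_funpow_fixes[OF xp x(2) p0, of 5] x(5) unfolding pdefs by (simp add: eval_nat_numeral)
  have all: "\<Omega> = {\<delta>, p0, p1, p2, p3, p4}" "distinct [\<delta>, p0, p1, p2, p3, p4]"
    using \<Gamma> \<Omega> by auto
  have "g ` Q = \<Omega> - g ` P" using part by blast
  then have Q: "g ` Q = {p1, p2, p3, p4}" using P all by auto
  then have p1Q: "p1 \<in> g ` Q" by simp
  define a where "a = w p1"
  define b where "b = w a"
  define c where "c = w b"
  note adefs = a_def b_def c_def
  have abc: "{p1, a, b, c} = {p1, p2, p3, p4}" "distinct [p1, a, b, c]"
    using cyclic_on_list[OF wp w(3) p1Q] cP(2) unfolding adefs Q by (simp_all add: eval_nat_numeral)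
  have ws: "w p1 = a" "w a = b" "w b = c" unfolding adefs by simp_all
  have wc: "w c = p1"
    using cyclic_on_funpow_fixes[OF wp w(3) p1Q, of 4] cP(2) unfolding adefs by (simp add: eval_nat_numeral)
  note vals = x\<delta> xs xp4 ws wc wp0 p0_def [symmetric]
  have "a \<in> {p2, p3, p4}" "b \<in> {p2, p3, p4}" "c \<in> {p2, p3, p4}" using abc by auto
  then consider "a = p2" "b = p3" "c = p4" | "a = p2" "b = p4" "c = p3" | "a = p3" "b = p2" "c = p4"
    | "a = p3" "b = p4" "c = p2" | "a = p4" "b = p2" "c = p3" | "a = p4" "b = p3" "c = p2"
    using abc(2) by auto
  then show ?thesis
  proof cases
    case 1
    have h: "x \<circ> x \<circ> w \<circ> w \<in> G" by (intro comp_mem x(1) w(1))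
    have "cycle_of_list [p0, p2, p1] \<in> G"
      by (rule three_cycle_memI[OF h]) (use vals 1 all in auto)
    then show ?thesis
      by (rule all_three_cycles_of_doubly_transitive[OF dt, rotated 3]) (use all in auto)
  next
    case 2
    have h: "x \<circ> x \<circ> w \<circ> w \<circ> w \<circ> x \<circ> w \<in> G" by (intro comp_mem x(1) w(1))
    have "cycle_of_list [p0, p2, \<delta>] \<in> G"
      by (rule three_cycle_memI[OF h]) (use vals 2 all in auto)
    then show ?thesis
      by (rule all_three_cycles_of_doubly_transitive[OF dt, rotated 3]) (use all in auto)
  next
    case 3
    have h: "x \<circ> w \<circ> w \<in> G" by (intro comp_mem x(1) w(1))
    have "cycle_of_list [p0, p1, p3] \<in> G"
      by (rule three_cycle_memI[OF h]) (use vals 3 all in auto)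
    then show ?thesis
      by (rule all_three_cycles_of_doubly_transitive[OF dt, rotated 3]) (use all in auto)
  next
    case 4
    have h: "x \<circ> x \<circ> w \<circ> x \<circ> w \<circ> w \<circ> w \<in> G" by (intro comp_mem x(1) w(1))
    have "cycle_of_list [p0, p2, \<delta>] \<in> G"
      by (rule three_cycle_memI[OF h]) (use vals 4 all in auto)
    then show ?thesis
      by (rule all_three_cycles_of_doubly_transitive[OF dt, rotated 3]) (use all in auto)
  next
    case 5
    have h: "x \<circ> x \<circ> w \<in> G" by (intro comp_mem x(1) w(1))
    have "cycle_of_list [p0, \<delta>, p2] \<in> G"
      by (rule three_cycle_memI[OF h]) (use vals 5 all in auto)
    then show ?thesis
      by (rule all_three_cycles_of_doubly_transitive[OF dt, rotated 3]) (use all in auto)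
  next
    case 6
    have h: "x \<circ> w \<in> G" by (intro comp_mem x(1) w(1))
    have "cycle_of_list [p0, \<delta>, p1] \<in> G"
      by (rule three_cycle_memI[OF h]) (use vals 6 all in auto)
    then show ?thesis
      by (rule all_three_cycles_of_doubly_transitive[OF dt, rotated 3]) (use all in auto)
  qed
qed

end

section \<open>Permutations with prescribed cycles\<close>

lemma all_cycles_of_length_conj:
  assumes x: "all_cycles_of_length p \<Omega> x" and k: "k permutes \<Omega>"
  shows "all_cycles_of_length p \<Omega> (k \<circ> x \<circ> inv' k)"
  unfolding all_cycles_of_length_def
proof (intro allI impI)
  fix C assume C: "C \<subseteq> \<Omega>" "cyclic_on (k \<circ> x \<circ> inv' k) C"
  have "cyclic_on x (inv' k ` C)"
    by (rule cyclic_on_image[OF C(2)]) (simp add: permutes_inverses[OF k])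
  moreover have "inv' k ` C \<subseteq> \<Omega>"
    using C(1) permutes_in_image[OF permutes_inv[OF k]] by auto
  moreover have "card (inv' k ` C) = card C"
    using permutes_inj_on[OF permutes_inv[OF k]] by (rule card_image)
  ultimately show "card C = p" using x unfolding all_cycles_of_length_def by metis
qed

lemma permutes_of_bij:
  assumes "bij f" "\<And>u. u \<notin> A \<Longrightarrow> f u = u"
  shows "f permutes A"
  using assms by (simp add: permutes_def bij_iff)

lemma permutes_conj:
  assumes "y permutes A" "bij k"
  shows "(k \<circ> y \<circ> inv' k) permutes (k ` A)"
proof (rule permutes_of_bij)
  show "bij (k \<circ> y \<circ> inv' k)" using assms by (simp add: bij_comp bij_imp_bij_inv permutes_bij)
  fix u assume u: "u \<notin> k ` A"
  have "k (inv' k u) = u" using assms(2) by (simp add: bij_is_surj surj_f_inv_f)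
  then have "inv' k u \<notin> A" using u by (metis image_eqI)
  then show "(k \<circ> y \<circ> inv' k) u = u"
    using permutes_not_in[OF assms(1)] \<open>k (inv' k u) = u\<close> by simp
qed

lemma permutation_group_generate:
  assumes "S \<subseteq> carrier (alt_group n)"
  shows "permutation_group {1..n} (generate (alt_group n) S)"
proof -
  interpret A: group "alt_group n" by (rule alt_group_is_group)
  interpret H: subgroup "generate (alt_group n) S" "alt_group n"
    by (rule A.generate_is_subgroup[OF assms])
  show ?thesis
  proof
    show "g permutes {1..n}" if "g \<in> generate (alt_group n) S" for g
      using H.subset that alt_group_carrier by blast
    show "id \<in> generate (alt_group n) S" using H.one_closed by (simp add: alt_group_one)
    show "g \<circ> h \<in> generate (alt_group n) S"
      if "g \<in> generate (alt_group n) S" "h \<in> generate (alt_group n) S" for g h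
      using H.m_closed[OF that] by (simp add: alt_group_mult)
    show "inv' g \<in> generate (alt_group n) S" if "g \<in> generate (alt_group n) S" for g
      using H.m_inv_closed[OF that] alt_group_inv_equality H.subset that by (metis subsetD)
  qed simp
qed

text \<open>The conjugates may be taken in the full symmetric group, and nothing about the group has to be
  known except that it contains them: it suffices to find all 3-cycles in it.\<close>
lemma generate_invariablyI:
  assumes x: "x \<in> carrier (alt_group n)" and y: "y \<in> carrier (alt_group n)"
    and gen: "\<And>G k l. permutation_group {1..n} G \<Longrightarrow> k permutes {1..n} \<Longrightarrow> l permutes {1..n} \<Longrightarrow>
      k \<circ> x \<circ> inv' k \<in> G \<Longrightarrow> l \<circ> y \<circ> inv' l \<in> G \<Longrightarrow> permutation_group.all_three_cycles {1..n} G"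
  shows "generate_invariably (alt_group n) x y"
proof -
  interpret A: group "alt_group n" by (rule alt_group_is_group)
  have conj: "conj_by (alt_group n) u g = inv' g \<circ> u \<circ> inv' (inv' g) \<and> inv' g permutes {1..n}
      \<and> conj_by (alt_group n) u g \<in> carrier (alt_group n)"
    if "u \<in> carrier (alt_group n)" "g \<in> carrier (alt_group n)" for u g
  proof -
    have g: "g permutes {1..n}" using that(2) by (simp add: alt_group_carrier)
    have "conj_by (alt_group n) u g = inv' g \<circ> u \<circ> g"
      unfolding conj_by_def by (simp add: alt_group_inv_equality[OF that(2)] alt_group_mult)
    moreover have "inv' (inv' g) = g" by (rule permutes_inv_inv[OF g])
    moreover have "conj_by (alt_group n) u g \<in> carrier (alt_group n)"
      unfolding conj_by_def using that by simp
    ultimately show ?thesis using permutes_inv[OF g] by simp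
  qed
  have "generate (alt_group n) {conj_by (alt_group n) x g, conj_by (alt_group n) y h} = carrier (alt_group n)"
    if g: "g \<in> carrier (alt_group n)" and h: "h \<in> carrier (alt_group n)" for g h
  proof -
    define S where "S = {conj_by (alt_group n) x g, conj_by (alt_group n) y h}"
    have S: "S \<subseteq> carrier (alt_group n)" using conj[OF x g] conj[OF y h] unfolding S_def by blast
    interpret P: permutation_group "{1..n}" "generate (alt_group n) S"
      by (rule permutation_group_generate[OF S])
    have "conj_by (alt_group n) x g \<in> generate (alt_group n) S" "conj_by (alt_group n) y h \<in> generate (alt_group n) S"
      unfolding S_def by (simp_all add: generate.incl)
    then have all: "P.all_three_cycles"
      using gen[OF P.permutation_group_axioms, of "inv' g" "inv' h"] conj[OF x g] conj[OF y h] by simp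
    have "three_cycles n \<subseteq> generate (alt_group n) S"
    proof
      fix c assume "c \<in> three_cycles n"
      then obtain cs where cs: "c = cycle_of_list cs" "distinct cs" "length cs = 3" "set cs \<subseteq> {1..n}" by blast
      then have "cs = [cs ! 0, cs ! 1, cs ! 2]" by (intro stupid_lemma)
      then obtain u v w where "cs = [u, v, w]" by blast
      then show "c \<in> generate (alt_group n) S" using all cs unfolding P.all_three_cycles_def by auto
    qed
    then have "carrier (alt_group n) \<subseteq> generate (alt_group n) S"
      unfolding alt_group_carrier_as_three_cycles
      using A.generate_subgroup_incl A.generate_is_subgroup[OF S] by blast
    then show ?thesis using A.generate_incl[OF S] unfolding S_def by blast
  qed
  then show ?thesis unfolding generate_invariably_def using x y by blast
qed

lemma ord_alt_group_eq_prime: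
  assumes x: "x \<in> carrier (alt_group n)" and p: "prime p" and pow: "x ^^ p = id" and ne: "x \<noteq> id"
  shows "group.ord (alt_group n) x = p"
proof -
  interpret A: group "alt_group n" by (rule alt_group_is_group)
  have "x [^]\<^bsub>alt_group n\<^esub> k = x ^^ k" for k :: nat
    by (induction k) (simp_all add: alt_group_one alt_group_mult A.nat_pow_Suc funpow_Suc_right del: funpow.simps(2))
  then have "x [^]\<^bsub>alt_group n\<^esub> p = \<one>\<^bsub>alt_group n\<^esub>" using pow by (simp add: alt_group_one)
  then have "A.ord x dvd p" using A.pow_eq_id[OF x] by simp
  moreover have "A.ord x \<noteq> 1" using A.ord_eq_1[OF x] ne by (simp add: alt_group_one)
  ultimately show ?thesis using p unfolding prime_nat_iff by blast
qed

text \<open>Squares are even, so the permutation is built as \<open>r\<^sup>2\<close>, where \<open>r\<close> rotates consecutive intervals of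
  length \<open>d\<close>. For odd \<open>p\<close> take \<open>d = p\<close>, as squaring keeps the length of odd cycles; for \<open>p = 2\<close> take \<open>d = 4\<close>, as
  squaring a 4-cycle gives two transpositions.\<close>
lemma exists_even_permutation_with_cycles_of_prime_length:
  assumes p: "prime p" "p dvd n" and par: "odd p \<or> 4 dvd n"
  shows "\<exists>x\<in>carrier (alt_group n). x ^^ p = id \<and> all_cycles_of_length p {1..n} x"
proof -
  define d where "d = (if odd p then p else 4)"
  have p2: "p \<ge> 2" using prime_ge_2_nat[OF p(1)] .
  have even_p: "p = 2" if "even p" using that p(1) primes_dvd_imp_eq two_is_prime_nat by blast
  have d: "d dvd n" "d > 2" "d dvd 2 * p"
    using p par p2 even_p unfolding d_def by (auto simp: le_less)
  \<comment> \<open>The interval of \<open>i\<close> starts at \<open>d * ((i - 1) div d) + 1\<close>; the position of \<open>i\<close> in it, counted from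
      0, is \<open>(i - 1) mod d\<close>, and \<open>i mod d\<close> is the next one.\<close>
  define r where "r i = (if i \<in> {1..n} then d * ((i - 1) div d) + i mod d + 1 else i)" for i
  have r_pow: "(r ^^ m) i = d * ((i - 1) div d) + (i - 1 + m) mod d + 1 \<and> (r ^^ m) i \<in> {1..n}"
    if i: "i \<in> {1..n}" for i m
  proof (induction m)
    case 0 then show ?case using i by simp
  next
    case (Suc m)
    define a b where "a = (i - 1) div d" and "b = (i - 1 + m) mod d"
    have b: "b < d" unfolding b_def using d(2) by simp
    have IH: "(r ^^ m) i = d * a + b + 1" "(r ^^ m) i \<in> {1..n}" using Suc unfolding a_def b_def by auto
    have "(d * a + b) div d = a" using b by simp
    moreover have "(d * a + b + 1) mod d = (i - 1 + Suc m) mod d"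
      unfolding b_def by (simp add: mod_simps add.assoc flip: Suc_eq_plus1)
    ultimately have e: "(r ^^ Suc m) i = d * a + (i - 1 + Suc m) mod d + 1"
      using IH by (simp add: r_def del: funpow.simps(2) add: funpow.simps(2)[of m r])
    have "a < n div d"
      unfolding a_def using i d(1,2) by (auto simp: div_less_iff_less_mult)
    then have "a + 1 \<le> n div d" by simp
    then have "d * (a + 1) \<le> n" using d(1) by (metis dvd_mult_div_cancel mult_le_mono2)
    moreover have "(i - 1 + Suc m) mod d < d" using d(2) by simp
    ultimately show ?case using e unfolding a_def by simp
  qed
  have r_id: "(r ^^ m) i = i" if "i \<notin> {1..n}" for i m using that by (induction m) (auto simp: r_def)
  have fix_iff: "(r ^^ m) i = i \<longleftrightarrow> d dvd m" if i: "i \<in> {1..n}" for i m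
  proof -
    have "i = d * ((i - 1) div d) + (i - 1) mod d + 1" using i by simp
    then have "(r ^^ m) i = i \<longleftrightarrow> (i - 1 + m) mod d = (i - 1) mod d" using r_pow[OF i, of m] by linarith
    also have "\<dots> \<longleftrightarrow> d dvd m" using mod_eq_dvd_iff_nat[of "i - 1" "i - 1 + m" d] by auto
    finally show ?thesis .
  qed
  have rd: "(r ^^ m) = id" if m: "d dvd m" for m
  proof
    show "(r ^^ m) i = id i" for i using fix_iff[of i m] r_id[of i m] m by (cases "i \<in> {1..n}") simp_all
  qed
  have "bij r"
  proof (rule o_bij)
    show "(r ^^ (d - 1)) \<circ> r = id" "r \<circ> (r ^^ (d - 1)) = id"
      using rd[of d] d(2) funpow.simps(2)[of "d - 1" r] funpow_Suc_right[of "d - 1" r] by simp_all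
  qed
  then have r: "r permutes {1..n}" by (rule permutes_of_bij) (unfold r_def, rule if_not_P)
  then have perm: "permutation r" using permutation_permutes by blast
  define x where "x = r ^^ 2"
  have xr: "x = r \<circ> r" unfolding x_def by (simp add: numeral_2_eq_2)
  have x: "x permutes {1..n}" unfolding xr by (rule permutes_compose[OF r r])
  moreover have "evenperm x" unfolding xr using evenperm_comp[OF perm perm] by simp
  ultimately have "x \<in> carrier (alt_group n)" by (simp add: alt_group_carrier)
  moreover have xp: "x ^^ p = id" unfolding x_def using rd[OF d(3)] by (simp add: funpow_mult)
  moreover have "all_cycles_of_length p {1..n} x" unfolding all_cycles_of_length_def
  proof (intro allI impI)
    fix C assume C: "C \<subseteq> {1..n}" "cyclic_on x C"
    have xperm: "permutation x" using x permutation_permutes by blast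
    obtain u where u: "u \<in> C" using C(2) unfolding cyclic_on_def by blast
    have "card C dvd p" using cyclic_on_funpow_fixes_iff[OF xperm C(2) u, of p] xp by simp
    moreover have "\<not> card C dvd 1"
      using cyclic_on_funpow_fixes_iff[OF xperm C(2) u, of 1] fix_iff[of u 2] u C(1) d(2) dvd_imp_le[of d 2]
      unfolding x_def by auto
    ultimately show "card C = p" using p(1) by (auto simp: prime_nat_iff)
  qed
  ultimately show ?thesis by blast
qed

lemma cyclic_on_cycle_of_list:
  assumes "distinct cs" "cs \<noteq> []"
  shows "cyclic_on (cycle_of_list cs) (set cs)"
proof -
  define f where "f = cycle_of_list cs"
  have perm: "permutation f" unfolding f_def by (rule permutation_of_cycle)
  have f: "f permutes set cs" unfolding f_def by (rule cycle_permutes)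
  have hd: "hd cs \<in> set cs" using assms(2) by simp
  have "v \<in> Orbits.orbit f (hd cs)" if "v \<in> set cs" for v
  proof -
    obtain i where i: "i < length cs" "v = cs ! i" using \<open>v \<in> set cs\<close> by (metis in_set_conv_nth)
    have "hd (map (f ^^ i) cs) = hd (rotate i cs)"
      using cyclic_rotation[OF assms(1), of i] unfolding f_def by simp
    then have "(f ^^ i) (hd cs) = v" using assms(2) i by (simp add: hd_map hd_rotate_conv_nth)
    then show ?thesis unfolding orbit_altdef_permutation[OF perm] by blast
  qed
  then have "set cs = Orbits.orbit f (hd cs)" using permutes_orbit_subset[OF f hd] by blast
  then show ?thesis unfolding f_def[symmetric] by (rule cyclic_on_singleI[OF hd])
qed

lemma evenperm_cycle_of_list:
  assumes "distinct cs" "cs \<noteq> []"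
  shows "evenperm (cycle_of_list cs) \<longleftrightarrow> odd (length cs)"
proof -
  have "swapidseq (length cs - 1) (cycle_of_list cs)"
    using swapidseq_ext_imp_swapidseq[OF swapidseq_ext_of_cycles[OF assms(1)]] .
  then have "evenperm (cycle_of_list cs) \<longleftrightarrow> even (length cs - 1)" by (rule evenperm_unique) simp
  then show ?thesis using assms(2) by (cases cs) auto
qed

lemma exists_two_cycles:
  assumes "0 < a" "a < n" "even n"
  shows "\<exists>y\<in>carrier (alt_group n). cyclic_on y {1..a} \<and> cyclic_on y {a+1..n}"
proof -
  define f g where "f = cycle_of_list [1..<a+1]" and "g = cycle_of_list [a+1..<n+1]"
  have s: "set [1..<a+1] = {1..a}" "set [a+1..<n+1] = {a+1..n}" by auto
  have f: "f permutes {1..a}" "cyclic_on f {1..a}" "evenperm f \<longleftrightarrow> odd a"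
    using cycle_permutes[of "[1..<a+1]"] cyclic_on_cycle_of_list[of "[1..<a+1]"] 
      evenperm_cycle_of_list[of "[1..<a+1]"] assms(1) unfolding f_def s by simp_all
  have g: "g permutes {a+1..n}" "cyclic_on g {a+1..n}" "evenperm g \<longleftrightarrow> odd (n - a)"
    using cycle_permutes[of "[a+1..<n+1]"] cyclic_on_cycle_of_list[of "[a+1..<n+1]"]
      evenperm_cycle_of_list[of "[a+1..<n+1]"] assms(2) unfolding g_def s by simp_all
  have dj: "{1..a} \<inter> {a+1..n} = {}" by auto
  have "f permutes {1..n}" using permutes_subset[OF f(1)] assms(2) by auto
  moreover have "g permutes {1..n}" using permutes_subset[OF g(1)] by auto
  ultimately have "f \<circ> g permutes {1..n}" by (intro permutes_compose)
  moreover have "permutation f" "permutation g" unfolding f_def g_def by (rule permutation_of_cycle)+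
  then have "evenperm (f \<circ> g)" using evenperm_comp f(3) g(3) assms by auto
  ultimately have "f \<circ> g \<in> carrier (alt_group n)" by (simp add: alt_group_carrier)
  moreover have "cyclic_on (f \<circ> g) {1..a}"
    by (rule permutes_comp_preserves_cyclic1[OF g(1) f(2) dj]) simp
  moreover have "cyclic_on (f \<circ> g) {a+1..n}"
    by (rule permutes_comp_preserves_cyclic2[OF f(1) g(2) dj]) simp
  ultimately show ?thesis by blast
qed

lemma exists_double_transposition_cycle:
  assumes "odd n" "n \<ge> 5"
  shows "\<exists>y\<in>carrier (alt_group n). cyclic_on y {1, 2} \<and> cyclic_on y {3, 4} \<and> cyclic_on y {5..n}"
proof -
  define f g h where "f = cycle_of_list [1, 2::nat]" and "g = cycle_of_list [3, 4::nat]"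
    and "h = cycle_of_list [5..<n+1]"
  have s: "set [5..<n+1] = {5..n}" by auto
  have f: "f permutes {1, 2}" "cyclic_on f {1, 2}" "\<not> evenperm f"
    using cycle_permutes[of "[1, 2::nat]"] cyclic_on_cycle_of_list[of "[1, 2::nat]"]
      evenperm_cycle_of_list[of "[1, 2::nat]"] unfolding f_def by simp_all
  have g: "g permutes {3, 4}" "cyclic_on g {3, 4}" "\<not> evenperm g"
    using cycle_permutes[of "[3, 4::nat]"] cyclic_on_cycle_of_list[of "[3, 4::nat]"]
      evenperm_cycle_of_list[of "[3, 4::nat]"] unfolding g_def by simp_all
  have h: "h permutes {5..n}" "cyclic_on h {5..n}" "evenperm h"
    using cycle_permutes[of "[5..<n+1]"] cyclic_on_cycle_of_list[of "[5..<n+1]"]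
      evenperm_cycle_of_list[of "[5..<n+1]"] assms unfolding h_def s by simp_all
  have gh: "g \<circ> h permutes {3..n}"
    using permutes_subset[OF g(1), of "{3..n}"] permutes_subset[OF h(1), of "{3..n}"] assms(2)
    by (intro permutes_compose) auto
  have dj: "{1, 2} \<inter> {3..n} = {}" "{3, 4} \<inter> {5..n} = {}" by auto
  have "f permutes {1..n}" using permutes_subset[OF f(1)] assms(2) by auto
  moreover have "g \<circ> h permutes {1..n}" using permutes_subset[OF gh] by auto
  ultimately have "f \<circ> (g \<circ> h) permutes {1..n}" by (metis permutes_compose)
  moreover have p: "permutation f" "permutation g" "permutation h"
    unfolding f_def g_def h_def by (rule permutation_of_cycle)+
  then have "evenperm (f \<circ> (g \<circ> h))"
    using evenperm_comp permutation_compose f(3) g(3) h(3) by metis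
  ultimately have "f \<circ> (g \<circ> h) \<in> carrier (alt_group n)" by (simp add: alt_group_carrier)
  moreover have "cyclic_on (f \<circ> (g \<circ> h)) {1, 2}"
    by (rule permutes_comp_preserves_cyclic1[OF gh f(2) dj(1)]) simp
  moreover have "cyclic_on (g \<circ> h) {3, 4}"
    by (rule permutes_comp_preserves_cyclic1[OF h(1) g(2) dj(2)]) simp
  then have "cyclic_on (f \<circ> (g \<circ> h)) {3, 4}"
    by (rule permutes_comp_preserves_cyclic2[OF f(1) _ dj(1)]) (use assms in auto)
  moreover have "cyclic_on (g \<circ> h) {5..n}"
    by (rule permutes_comp_preserves_cyclic2[OF g(1) h(2) dj(2)]) simp
  then have "cyclic_on (f \<circ> (g \<circ> h)) {5..n}"
    by (rule permutes_comp_preserves_cyclic2[OF f(1) _ dj(1)]) auto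
  ultimately show ?thesis by blast
qed

text \<open>With \<open>n = 2 m\<close> and \<open>j\<close> the element of \<open>{1, 2}\<close> that makes \<open>m - j\<close> odd, a prime factor of \<open>m - j\<close>
  dividing \<open>n\<close> would divide \<open>n - 2 (m - j) = 2 j\<close>, a power of 2.\<close>
lemma exists_prime_non_divisor:
  fixes n :: nat
  assumes "even n" "n \<ge> 8"
  shows "\<exists>q. prime q \<and> \<not> q dvd n \<and> 2 * q < n"
proof -
  define m j where "m = n div 2" and "j = (if even m then 1 else 2 :: nat)"
  have m: "n = 2 * m" "m \<ge> 4" unfolding m_def using assms by auto
  have "m \<noteq> 4 \<Longrightarrow> m \<ge> 5" using m(2) by simp
  then have mj: "odd (m - j)" "m - j \<noteq> 1" "j \<le> m" "0 < j" unfolding j_def using m(2) by (cases "m = 4"; auto)+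
  obtain q where q: "prime q" "q dvd m - j" using prime_factor_nat[OF mj(2)] by blast
  have "odd q" using q(2) mj(1) dvd_trans by blast
  have "\<not> q dvd n"
  proof
    assume "q dvd n"
    moreover have "q dvd 2 * (m - j)" using q(2) by simp
    ultimately have "q dvd n - 2 * (m - j)" by (rule dvd_diff_nat)
    then have "q dvd 2 * j" using mj(3) m(1) by (simp add: diff_mult_distrib2)
    moreover have "2 * j dvd 2 ^ 2" unfolding j_def by simp
    ultimately have "q dvd 2 ^ 2" by (rule dvd_trans)
    then have "q dvd 2" using prime_dvd_power q(1) by blast
    then show False using \<open>odd q\<close> q(1) primes_dvd_imp_eq two_is_prime_nat by blast
  qed
  moreover have "m - j > 0" using mj(1) by (metis even_zero gr0I)
  then have "q \<le> m - j" using q(2) by (rule dvd_imp_le[rotated])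
  then have "2 * q < n" using m mj by linarith
  ultimately show ?thesis using q(1) by blast
qed

text \<open>The last condition is what makes an even permutation with cycles of length \<open>p\<close> possible: \<open>n / 2\<close>
  transpositions form an even permutation only if 4 divides \<open>n\<close>.\<close>
lemma exists_prime_divisor:
  fixes n :: nat
  assumes "n \<ge> 3"
  shows "\<exists>p. prime p \<and> p dvd n \<and> (odd p \<or> 4 dvd n)"
proof (cases "4 dvd n")
  case True
  then have "2 dvd n" by (rule dvd_trans[rotated]) simp
  then show ?thesis using True two_is_prime_nat by blast
next
  case False
  define m where "m = (if even n then n div 2 else n)"
  have m: "odd m" "m dvd n" "m \<noteq> 1"
    using False assms unfolding m_def by (auto elim!: evenE)
  obtain p where p: "prime p" "p dvd m" using prime_factor_nat[OF m(3)] by blast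
  then have "odd p" using m(1) dvd_trans by blast
  then show ?thesis using p m(2) dvd_trans by blast
qed

section \<open>Invariable generation of alternating groups\<close>

theorem proposition1p3:
  fixes n :: nat
  assumes "n \<ge> 5"
  shows "\<exists>x \<in> carrier (alt_group n). \<exists>y \<in> carrier (alt_group n).
           (Factorial_Ring.prime (group.ord (alt_group n) x) \<or>
            Factorial_Ring.prime (group.ord (alt_group n) y)) \<and>
           generate_invariably (alt_group n) x y"
proof (cases "n = 6")
  case True
  define x :: "nat \<Rightarrow> nat" where "x = cycle_of_list [1..<6]"
  have s: "set [1..<6] = {1..5::nat}" by auto
  have x: "x permutes {1..5}" "cyclic_on x {1..5}" "evenperm x"
    using cycle_permutes[of "[1..<6]"] cyclic_on_cycle_of_list[of "[1..<6]"]
      evenperm_cycle_of_list[of "[1..<6]"] unfolding x_def s by simp_all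
  have xA: "x \<in> carrier (alt_group n)"
    using permutes_subset[OF x(1)] x(3) True by (auto simp: alt_group_carrier)
  have xperm: "permutation x" unfolding x_def by (rule permutation_of_cycle)
  have "(x ^^ 5) u = u" for u
  proof (cases "u \<in> {1..5}")
    case True
    then show ?thesis using cyclic_on_funpow_fixes[OF xperm x(2), of u 5] by simp
  next
    case False
    then show ?thesis using permutes_not_in[OF permutes_funpow[OF x(1)]] by blast
  qed
  then have "x ^^ 5 = id" by auto
  moreover have "(x ^^ 1) 1 \<noteq> 1" using cyclic_on_funpow_fixes_iff[OF xperm x(2), of 1 1] by simp
  then have "x \<noteq> id" by auto
  moreover have p5: "prime (5::nat)" by simp
  ultimately have "group.ord (alt_group n) x = 5" using ord_alt_group_eq_prime[OF xA] by blast
  then have ord: "prime (group.ord (alt_group n) x)" using p5 by simp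
  obtain y where y: "y \<in> carrier (alt_group n)" "cyclic_on y {1..2}" "cyclic_on y {2+1..n}"
    using exists_two_cycles[of 2 n] True by auto
  have "generate_invariably (alt_group n) x y"
  proof (rule generate_invariablyI[OF xA y(1)])
    fix G k l assume G: "permutation_group {1..n} G" and kl: "k permutes {1..n}" "l permutes {1..n}"
      and mem: "k \<circ> x \<circ> inv' k \<in> G" "l \<circ> y \<circ> inv' l \<in> G"
    interpret permutation_group "{1..n}" G by (rule G)
    have b: "bij k" "bij l" "inj k" "inj l" using kl permutes_bij permutes_inj by blast+
    show "all_three_cycles"
    proof (rule all_three_cycles_degree_six[OF _ mem(1) cyclic_on_conj[OF x(2) b(1)] permutes_conj[OF x(1) b(1)] _ _
          mem(2) cyclic_on_conj[OF y(2) b(2)] cyclic_on_conj[OF y(3) b(2)]])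
      have "{1..5} \<subseteq> {1..n}" using True by simp
      then show "k ` {1..5} \<subseteq> {1..n}" using image_mono[of "{1..5}" "{1..n}" k] permutes_image[OF kl(1)] by simp
      have "{1..2} \<union> {2+1..n} = {1..n}" using True by auto
      then show "l ` {1..2} \<union> l ` {2+1..n} = {1..n}" using permutes_image[OF kl(2)] by (simp flip: image_Un)
      show "l ` {1..2} \<inter> l ` {2+1..n} = {}" using b(4) by (auto simp: inj_eq)
    qed (use True b in \<open>simp_all add: card_image inj_on_subset\<close>)
  qed
  then show ?thesis using xA y(1) ord by blast
next
  case n6: False
  obtain p where p: "prime p" "p dvd n" "odd p \<or> 4 dvd n"
    using exists_prime_divisor[of n] assms by auto
  obtain x where x: "x \<in> carrier (alt_group n)" "x ^^ p = id" "all_cycles_of_length p {1..n} x"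
    using exists_even_permutation_with_cycles_of_prime_length[OF p] by blast
  have "x \<noteq> id"
  proof
    assume "x = id"
    then have "Orbits.orbit x 1 = {1}" by (simp only: orbit_eq_singleton_iff id_apply)
    then have "cyclic_on x {1}" unfolding cyclic_on_def by blast
    then have "card {1::nat} = p" using x(3) assms unfolding all_cycles_of_length_def by auto
    then show False using prime_ge_2_nat[OF p(1)] by simp
  qed
  then have ord: "prime (group.ord (alt_group n) x)"
    using ord_alt_group_eq_prime[OF x(1) p(1) x(2)] p(1) by simp
  have "\<exists>y\<in>carrier (alt_group n). generate_invariably (alt_group n) x y"
  proof -
    consider "prime n" | "even n" "n \<ge> 8" | "odd n" "n \<ge> 9"
    proof -
      have "prime (5::nat)" "prime (7::nat)" by simp_all
      then have "\<not> prime n \<Longrightarrow> n \<noteq> 5 \<and> n \<noteq> 7" by auto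
      moreover have "n = 5 \<or> n = 7 \<or> n \<ge> 8" using assms n6 by presburger
      moreover have "odd n \<Longrightarrow> n \<ge> 8 \<Longrightarrow> n \<ge> 9" by presburger
      ultimately show thesis using that by blast
    qed
    then show ?thesis
    proof cases
      case 1
      then have pn: "p = n" using p(1,2) primes_dvd_imp_eq by blast
      define y :: "nat \<Rightarrow> nat" where "y = cycle_of_list [1, 2, 3]"
      have y: "y permutes {1..3}" "cyclic_on y {1..3}" "evenperm y"
      proof -
        have s: "set [1, 2, 3] = {1..3::nat}" by auto
        show "y permutes {1..3}" unfolding y_def s [symmetric] by (rule cycle_permutes)
        show "cyclic_on y {1..3}" unfolding y_def s [symmetric] by (rule cyclic_on_cycle_of_list) simp_all
        show "evenperm y" unfolding y_def by (subst evenperm_cycle_of_list) simp_all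
      qed
      have yA: "y \<in> carrier (alt_group n)"
        using permutes_subset[OF y(1)] y(3) assms by (auto simp: alt_group_carrier)
      have "generate_invariably (alt_group n) x y"
      proof (rule generate_invariablyI[OF x(1) yA])
        fix G k l assume G: "permutation_group {1..n} G" and kl: "k permutes {1..n}" "l permutes {1..n}"
          and mem: "k \<circ> x \<circ> inv' k \<in> G" "l \<circ> y \<circ> inv' l \<in> G"
        interpret permutation_group "{1..n}" G by (rule G)
        have b: "bij l" "inj l" using kl permutes_bij permutes_inj by blast+
        show "all_three_cycles"
        proof (rule all_three_cycles_prime_degree[OF mem(1) _ _ _ mem(2)
              cyclic_on_conj[OF y(2) b(1)] permutes_conj[OF y(1) b(1)]])
          show "all_cycles_of_length (card {1..n}) {1..n} (k \<circ> x \<circ> inv' k)"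
            using all_cycles_of_length_conj[OF x(3) kl(1)] pn by simp
          have "{1..3} \<subseteq> {1..n}" using assms by simp
          then show "l ` {1..3} \<subseteq> {1..n}" using image_mono[of "{1..3}" "{1..n}" l] permutes_image[OF kl(2)] by simp
        qed (use 1 assms b in \<open>simp_all add: card_image inj_on_subset\<close>)
      qed
      then show ?thesis using yA by blast
    next
      case 2
      obtain q where q: "prime q" "\<not> q dvd n" "2 * q < n" using exists_prime_non_divisor[OF 2] by blast
      obtain y where y: "y \<in> carrier (alt_group n)" "cyclic_on y {1..q}" "cyclic_on y {q+1..n}"
        using exists_two_cycles[of q n] q 2(1) prime_gt_0_nat by auto
      have "generate_invariably (alt_group n) x y"
      proof (rule generate_invariablyI[OF x(1) y(1)])
        fix G k l assume G: "permutation_group {1..n} G" and kl: "k permutes {1..n}" "l permutes {1..n}"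
          and mem: "k \<circ> x \<circ> inv' k \<in> G" "l \<circ> y \<circ> inv' l \<in> G"
        interpret permutation_group "{1..n}" G by (rule G)
        have b: "bij l" "inj l" using kl permutes_bij permutes_inj by blast+
        have cq: "card (l ` {1..q}) = q" using b by (simp add: card_image inj_on_subset)
        show "all_three_cycles"
        proof (rule all_three_cycles_two_cycles[OF mem(1) all_cycles_of_length_conj[OF x(3) kl(1)] p(1) _ mem(2)
              cyclic_on_conj[OF y(2) b(1)] cyclic_on_conj[OF y(3) b(1)]])
          have "{1..q} \<union> {q+1..n} = {1..n}" using q(3) by auto
          then show "l ` {1..q} \<union> l ` {q+1..n} = {1..n}" using permutes_image[OF kl(2)] by (simp flip: image_Un)
          show "l ` {1..q} \<inter> l ` {q+1..n} = {}" using b(2) by (auto simp: inj_eq)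
        qed (use cq q p(2) in simp_all)
      qed
      then show ?thesis using y(1) by blast
    next
      case 3
      obtain y where y: "y \<in> carrier (alt_group n)" "cyclic_on y {1, 2}" "cyclic_on y {3, 4}" "cyclic_on y {5..n}"
        using exists_double_transposition_cycle[of n] 3 by auto
      have "generate_invariably (alt_group n) x y"
      proof (rule generate_invariablyI[OF x(1) y(1)])
        fix G k l assume G: "permutation_group {1..n} G" and kl: "k permutes {1..n}" "l permutes {1..n}"
          and mem: "k \<circ> x \<circ> inv' k \<in> G" "l \<circ> y \<circ> inv' l \<in> G"
        interpret permutation_group "{1..n}" G by (rule G)
        have b: "bij l" "inj l" using kl permutes_bij permutes_inj by blast+
        show "all_three_cycles"
        proof (rule all_three_cycles_double_transposition[OF mem(1) all_cycles_of_length_conj[OF x(3) kl(1)] p(1) _ mem(2)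
              cyclic_on_conj[OF y(2) b(1)] cyclic_on_conj[OF y(3) b(1)] cyclic_on_conj[OF y(4) b(1)]])
          have "{1, 2} \<union> {3, 4} \<union> {5..n} = {1..n}" using 3 by auto
          then show "l ` {1, 2} \<union> l ` {3, 4} \<union> l ` {5..n} = {1..n}"
            using permutes_image[OF kl(2)] by (simp only: image_Un [symmetric])
          show "l ` {1, 2} \<inter> l ` {3, 4} = {}" "l ` {1, 2} \<inter> l ` {5..n} = {}" "l ` {3, 4} \<inter> l ` {5..n} = {}"
            using b(2) by (auto simp: inj_eq)
        qed (use 3 p(2) b in \<open>simp_all add: card_image inj_on_subset inj_eq\<close>)
      qed
      then show ?thesis using y(1) by blast
    qed
  qed
  then show ?thesis using x(1) ord by blast
qed

end
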